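(* For $n,k\ge 1$, the number of reduced permutations of genus $1$ in $S_n$ with $k$ cycles is $$r_*(n,k)=\binom{n+2}{2k+2}\binom{k+1}{3}+\binom{n+1}{2k+2}\binom{k+1}{2}.$$ More precisely, for $j=0,1,2$ the number $r_j(n,k)$ of reduced permutations of genus $1$ in $S_n$ with exactly $j$ back points and $k$ cycles is $$r_0(n,k)=\binom{n}{2k}\binom{k+1}{3},\quad r_2(n,k)=\binom{n}{2k+2}\binom{k+2}{3},\quad r_1(n,k)=\binom{n}{2k+1}\left(\binom{k+2}{3}+\binom{k+1}{3}\right).$$
   Context: Permutations are composed right to left; $\zeta_n=(1,\dots,n)$; $z(\pi)$ is the number of cycles; the genus of $\alpha\in S_n$ is defined by $n+1-2g(\alpha)=z(\alpha)+z(\alpha^{-1}\zeta_n)$. An element $i$ is a back point of $\alpha$ if $\alpha(i)<i$ and $\alpha(i)$ is not the smallest element of its cycle. A trivial cycle is a cycle $(i,i+1,\dots,i+p)$ with entries modulo $n$ (fixed points included); $\alpha$ is reduced if it has no trivial cycle. Binomial coefficients $\binom{m}{r}$ vanish for $r>m$. *)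

theory Defs
  imports Complex_Main "HOL-Combinatorics.Cycles" "HOL-Combinatorics.Orbits"
begin

text \<open>
  The elements of \<open>S\<^sub>n\<close> are the functions \<open>\<alpha>\<close> with \<open>\<alpha> permutes {1..n}\<close>; since permutations
  are composed from right to left, the product is \<open>\<circ>\<close>.
\<close>

definition zeta :: "nat \<Rightarrow> nat \<Rightarrow> nat" where
  "zeta n = cycle_of_list [1..<Suc n]"

text \<open>Fixed points count as cycles.\<close>

definition num_cycles :: "nat \<Rightarrow> (nat \<Rightarrow> nat) \<Rightarrow> nat" where
  "num_cycles n \<pi> = card (orbit \<pi> ` {1..n})"

text \<open>
  The solution \<open>g\<close> of \<open>n + 1 - 2 * g = z(\<alpha>) + z(\<alpha>\<^sup>-\<^sup>1 \<zeta>\<^sub>n)\<close>.  It is computed in the rationals, so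
  that no truncation or rounding is built into the definition.
\<close>

definition genus :: "nat \<Rightarrow> (nat \<Rightarrow> nat) \<Rightarrow> rat" where
  "genus n \<alpha> =
     (of_nat n + 1 - (of_nat (num_cycles n \<alpha>) + of_nat (num_cycles n (inv \<alpha> \<circ> zeta n)))) / 2"

definition back_points :: "nat \<Rightarrow> (nat \<Rightarrow> nat) \<Rightarrow> nat set" where
  "back_points n \<alpha> = {i \<in> {1..n}. \<alpha> i < i \<and> \<alpha> i \<noteq> Min (orbit \<alpha> i)}"

text \<open>
  The entry \<open>i + j\<close> modulo \<open>n\<close>, with representatives in \<open>{1..n}\<close>, is \<open>(zeta n ^^ j) i\<close>.  The bound
  \<open>p < n\<close> makes the entries \<open>i, i + 1, \<dots>, i + p\<close> distinct modulo \<open>n\<close>; \<open>p = 0\<close> gives the fixed points.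
\<close>

definition has_trivial_cycle :: "nat \<Rightarrow> (nat \<Rightarrow> nat) \<Rightarrow> bool" where
  "has_trivial_cycle n \<alpha> \<longleftrightarrow>
     (\<exists>i\<in>{1..n}. \<exists>p<n. (\<forall>j<p. \<alpha> ((zeta n ^^ j) i) = (zeta n ^^ Suc j) i) \<and>
                        \<alpha> ((zeta n ^^ p) i) = i)"

definition reduced :: "nat \<Rightarrow> (nat \<Rightarrow> nat) \<Rightarrow> bool" where
  "reduced n \<alpha> \<longleftrightarrow> \<not> has_trivial_cycle n \<alpha>"

definition reduced_genus_one :: "nat \<Rightarrow> nat \<Rightarrow> (nat \<Rightarrow> nat) set" where
  "reduced_genus_one n k =
     {\<alpha>. \<alpha> permutes {1..n} \<and> reduced n \<alpha> \<and> genus n \<alpha> = 1 \<and> num_cycles n \<alpha> = k}"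

definition r_total :: "nat \<Rightarrow> nat \<Rightarrow> nat" where
  "r_total n k = card (reduced_genus_one n k)"

definition r_back :: "nat \<Rightarrow> nat \<Rightarrow> nat \<Rightarrow> nat" where
  "r_back j n k = card {\<alpha> \<in> reduced_genus_one n k. card (back_points n \<alpha>) = j}"

end

theory Submission
  imports Defs "HOL-Library.Infinite_Set" "HOL-Number_Theory.Cong"
begin

text \<open>
  Put \<open>\<beta> = \<alpha>\<^sup>-\<^sup>1 \<zeta>\<^sub>n\<close>. A cycle of \<open>\<alpha>\<close> is trivial iff at most one of its points is moved by \<open>\<beta>\<close>.
  Deleting the fixed points of \<open>\<beta>\<close> therefore turns a reduced permutation of genus one into a
  permutation of \<open>m\<close> points, its core, such that neither \<open>\<alpha>\<close> nor \<open>\<beta>\<close> has a fixed point; this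
  keeps the cycles and the back points of \<open>\<alpha>\<close>, and every \<open>m\<close>-subset of \<open>{1..n}\<close> can be the set of
  points that are not deleted.

  For a core, \<open>z(\<alpha>) + z(\<beta>) = m - 1\<close> forces all cycles to be transpositions up to a total excess
  of two. Placing \<open>\<alpha>\<close> on the even and \<open>\<beta>\<close> on the odd residues modulo \<open>2 m\<close> gives the corner map
  of a leafless one-face map on the torus. It is a reflection between consecutive points of the
  cycles of length at least three, of which there are four or six, and the gluing condition
  makes the configuration of these points invariant under translation by \<open>m\<close>: the face is
  a square or a hexagon with opposite sides identified. So the core is determined by two or three
  residues modulo \<open>m\<close>, whose gaps all have the parity of \<open>m\<close>. These residues are even if
  \<open>m = 2 k + 2\<close> and
  odd if \<open>m = 2 k\<close>, and if \<open>m = 2 k + 1\<close> there are three of them, of alternating parity; the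
  number of back points is \<open>m - 2 k\<close>.
\<close>

section \<open>Orbits and first return maps\<close>

text \<open>Deletion preserves genus one because each fixed point of \<beta> takes away one point
  and one cycle of \<beta>. In the one-face map of a core the \<open>m\<close> edges and
  \<open>m - 1\<close> vertices force the degrees, all at least two, to exceed two by two in total:
  there is one vertex of degree four, or there are two of degree three. Suppressing the vertices of
  degree two leaves 2 or 3 edges; this number is \<open>H\<close> throughout. Any orientable gluing
  of a square or hexagon other than that of opposite sides has a vertex of degree at most two, which
  the suppression has ruled out. The gaps have the parity of \<open>m\<close> because the rotation
  about the vertices preserves the parity of corners and sends each special corner to the next one
  translated by \<open>m\<close>. For odd \<open>m\<close> the parities alternate while translation
  by \<open>m\<close> reverses them, so a square cannot occur. The binomial coefficients in
  \<open>k\<close> count the remaining choices of residues, those in \<open>n\<close> the choices of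
  the points that are kept.\<close>

lemma zeta_permutes: "zeta n permutes {1..n}"
  unfolding zeta_def using cycle_permutes[of "[1..<Suc n]"] by (simp add: atLeastLessThanSuc_atLeastAtMost del: upt_Suc)

lemma zeta_apply:
  assumes "i \<in> {1..n}"
  shows "zeta n i = (if i = n then 1 else Suc i)"
proof -
  have "map (zeta n) [1..<Suc n] = rotate1 [1..<Suc n]"
    using cyclic_rotation[of "[1..<Suc n]" 1] by (simp add: zeta_def del: upt_Suc)
  then have "map (zeta n) [1..<Suc n] ! (i - 1) = rotate1 [1..<Suc n] ! (i - 1)" by simp
  then show ?thesis using assms
    by (auto simp: nth_rotate1 simp del: upt_Suc)
qed

text \<open>The counterpart of \<open>zeta\<close> for cores, whose points are numbered from 0 by
  their rank.\<close>

definition cyc :: "nat \<Rightarrow> nat \<Rightarrow> nat" where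
  "cyc m i = (if i < m then Suc i mod m else i)"

lemma cyc_permutes: "cyc m permutes {..<m}"
proof (rule bij_imp_permutes)
  have "inj_on (cyc m) {..<m}"
  proof (rule inj_onI)
    fix x y assume "x \<in> {..<m}" "y \<in> {..<m}" "cyc m x = cyc m y"
    then show "x = y" by (cases "Suc x = m"; cases "Suc y = m") (auto simp: cyc_def)
  qed
  moreover have "cyc m ` {..<m} \<subseteq> {..<m}" by (auto simp: cyc_def)
  ultimately show "bij_betw (cyc m) {..<m} {..<m}"
    by (simp add: bij_betw_def endo_inj_surj)
qed (auto simp: cyc_def)

lemma permutes_self_in_orbit:
  assumes "f permutes A" "finite A"
  shows "x \<in> orbit f x"
  by (rule permutation_self_in_orbit) (use assms in \<open>auto simp: permutation_permutes\<close>)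

lemma orbit_eq_if_in:
  assumes "f permutes A" "finite A" "y \<in> orbit f x"
  shows "orbit f y = orbit f x"
proof -
  have "x \<in> orbit f y" using orbit_swap[OF permutes_self_in_orbit[OF assms(1,2)] assms(3)] .
  with assms(3) show ?thesis by (intro equalityI subsetI) (erule orbit_trans, assumption)+
qed

text \<open>\<open>g\<close> is the first return map of \<open>f\<close> on \<open>e ` B\<close>; \<open>N z\<close> is the index of the first point
  of \<open>e ` B\<close> met by the \<open>f\<close>-trajectory starting with \<open>z\<close> itself.\<close>

locale first_return =
  fixes f :: "'a \<Rightarrow> 'a" and A :: "'a set" and g :: "'b \<Rightarrow> 'b" and B :: "'b set"
    and N :: "'a \<Rightarrow> 'b" and e :: "'b \<Rightarrow> 'a"
  assumes f: "f permutes A" "finite A" and g: "g permutes B" "finite B"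
    and N_in: "z \<in> A \<Longrightarrow> N z \<in> B" and e_in: "i \<in> B \<Longrightarrow> e i \<in> A"
    and N_e: "i \<in> B \<Longrightarrow> N (e i) = i"
    and N_f_out: "z \<in> A \<Longrightarrow> z \<notin> e ` B \<Longrightarrow> N (f z) = N z"
    and N_f_in: "i \<in> B \<Longrightarrow> N (f (e i)) = g i"
    and e_N: "z \<in> A \<Longrightarrow> e (N z) \<in> orbit f z"
begin

lemma N_orbit:
  assumes "z \<in> A" "y \<in> orbit f z"
  shows "N y \<in> orbit g (N z)"
proof -
  have step: "N (f y) \<in> orbit g (N z)" if "y \<in> A" "N y \<in> orbit g (N z)" for y
    using that N_f_out N_f_in N_e orbit.step by (cases "y \<in> e ` B") auto
  show ?thesis using assms(2)
  proof induction
    case base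
    show ?case using step[OF assms(1)] permutes_self_in_orbit[OF g] by auto
  next
    case (step y)
    then show ?case using \<open>\<And>y. _ \<Longrightarrow> _ \<Longrightarrow> N (f y) \<in> _\<close> permutes_orbit_subset[OF f(1) assms(1)] by auto
  qed
qed

lemma e_orbit:
  assumes "z \<in> A" "i \<in> orbit g (N z)"
  shows "e i \<in> orbit f z"
proof -
  have step: "e (g i) \<in> orbit f z" if "i \<in> B" "e i \<in> orbit f z" for i
  proof -
    have "f (e i) \<in> orbit f z" using that orbit.step by metis
    moreover have "f (e i) \<in> A" using that e_in f permutes_in_image by metis
    ultimately show ?thesis using e_N[of "f (e i)"] N_f_in that orbit_trans by metis
  qed
  show ?thesis using assms(2)
  proof induction
    case base
    show ?case using step[OF N_in[OF assms(1)]] e_N[OF assms(1)] by auto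
  next
    case (step i)
    then show ?case using \<open>\<And>y. _ \<Longrightarrow> _ \<Longrightarrow> e (g y) \<in> _\<close> permutes_orbit_subset[OF g(1) N_in[OF assms(1)]] by auto
  qed
qed

lemma orbit_Int: 
  assumes "z \<in> A"
  shows "orbit f z \<inter> e ` B = e ` orbit g (N z)"
proof (intro equalityI subsetI)
  fix y assume "y \<in> orbit f z \<inter> e ` B"
  then obtain i where "i \<in> B" "y = e i" "e i \<in> orbit f z" by blast
  then show "y \<in> e ` orbit g (N z)" using N_orbit[OF assms] N_e by force
next
  fix y assume "y \<in> e ` orbit g (N z)"
  then show "y \<in> orbit f z \<inter> e ` B"
    using e_orbit[OF assms] permutes_orbit_subset[OF g(1) N_in[OF assms]] by auto
qed

text \<open>Every orbit of \<open>f\<close> meets the image of \<open>e\<close> by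
  \<open>e_N\<close>, and two orbits with the same set of indices share such a point. Hence passing
  to indices is a bijection between the orbits.\<close>

lemma card_orbits: "card (orbit f ` A) = card (orbit g ` B)"
proof -
  define h where "h X = N ` X" for X
  have hz: "h (orbit f z) = orbit g (N z)" if "z \<in> A" for z
  proof
    show "h (orbit f z) \<subseteq> orbit g (N z)" using N_orbit that by (auto simp: h_def)
    show "orbit g (N z) \<subseteq> h (orbit f z)"
    proof
      fix i assume i: "i \<in> orbit g (N z)"
      then have "N (e i) = i" using N_e permutes_orbit_subset[OF g(1) N_in[OF that]] by blast
      then show "i \<in> h (orbit f z)" using e_orbit[OF that i] unfolding h_def by (metis imageI)
    qed
  qed
  have "bij_betw h (orbit f ` A) (orbit g ` B)"
  proof (rule bij_betw_imageI)
    show "inj_on h (orbit f ` A)"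
    proof (rule inj_onI, clarify)
      fix y z assume yz: "y \<in> A" "z \<in> A" "h (orbit f y) = h (orbit f z)"
      then have "N y \<in> orbit g (N z)" using hz permutes_self_in_orbit[OF g] by metis
      then have "e (N y) \<in> orbit f z" using e_orbit yz by blast
      then show "orbit f y = orbit f z" using e_N[OF yz(1)] orbit_eq_if_in[OF f] by metis
    qed
    show "h ` orbit f ` A = orbit g ` B"
    proof (intro equalityI subsetI)
      fix X assume "X \<in> h ` orbit f ` A"
      then show "X \<in> orbit g ` B" using hz N_in by auto
    next
      fix X assume "X \<in> orbit g ` B"
      then obtain i where "i \<in> B" "X = orbit g i" by blast
      then show "X \<in> h ` orbit f ` A" using hz[OF e_in] N_e e_in by (metis imageI)
    qed
  qed
  then show ?thesis by (rule bij_betw_same_card)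
qed

end

section \<open>Removing the fixed points of the dual permutation\<close>

text \<open>Also meant for \<open>z\<close> outside \<open>S\<close>: it is then the index of the
  first element of \<open>S\<close> above \<open>z\<close>, or \<open>card S\<close> if there is
  none.\<close>

definition rank :: "nat set \<Rightarrow> nat \<Rightarrow> nat" where
  "rank S z = card {s \<in> S. s < z}"

lemma rank_mono: "finite S \<Longrightarrow> y \<le> z \<Longrightarrow> rank S y \<le> rank S z"
  unfolding rank_def by (rule card_mono) auto

lemma rank_Suc: "finite S \<Longrightarrow> rank S (Suc z) = rank S z + (if z \<in> S then 1 else 0)"
proof -
  assume "finite S"
  have "{s \<in> S. s < Suc z} = {s \<in> S. s < z} \<union> (if z \<in> S then {z} else {})" by (auto simp: less_Suc_eq)
  then show ?thesis using \<open>finite S\<close> by (auto simp: rank_def)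
qed

lemma rank_enumerate:
  assumes "finite S" "i < card S"
  shows "rank S (enumerate S i) = i"
proof -
  have "{s \<in> S. s < enumerate S i} = enumerate S ` {..<i}"
  proof
    show "{s \<in> S. s < enumerate S i} \<subseteq> enumerate S ` {..<i}"
    proof
      fix s assume s: "s \<in> {s \<in> S. s < enumerate S i}"
      then obtain j where "j < card S" "s = enumerate S j"
        using finite_enumerate_Ex assms by blast
      then show "s \<in> enumerate S ` {..<i}" using s assms by auto
    qed
    show "enumerate S ` {..<i} \<subseteq> {s \<in> S. s < enumerate S i}"
      using assms by (auto intro: finite_enumerate_in_set)
  qed
  moreover have "inj_on (enumerate S) {..<i}"
    using assms(2)
    by (intro inj_on_subset[OF bij_betw_imp_inj_on[OF finite_bij_enumerate[OF assms(1)]]]) auto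
  ultimately show ?thesis unfolding rank_def by (metis card_image card_lessThan)
qed

lemma enumerate_rank:
  assumes "finite S" "z \<in> S"
  shows "enumerate S (rank S z) = z" "rank S z < card S"
proof -
  obtain j where "j < card S" "z = enumerate S j"
    using finite_enumerate_Ex assms by blast
  then show "enumerate S (rank S z) = z" "rank S z < card S" using rank_enumerate[OF assms(1)] by auto
qed

lemma enumerate_image: "finite S \<Longrightarrow> enumerate S ` {..<card S} = S"
  by (simp add: bij_betw_imp_surj_on[OF finite_bij_enumerate])

definition lift_perm :: "nat set \<Rightarrow> (nat \<Rightarrow> nat) \<Rightarrow> nat \<Rightarrow> nat" where
  "lift_perm S b x = (if x \<in> S then enumerate S (b (rank S x)) else x)"

lemma lift_perm_enumerate:
  "finite S \<Longrightarrow> i < card S \<Longrightarrow> lift_perm S b (enumerate S i) = enumerate S (b i)"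
  by (simp add: lift_perm_def rank_enumerate finite_enumerate_in_set)

lemma lift_perm_permutes:
  assumes "finite S" "b permutes {..<card S}"
  shows "lift_perm S b permutes S"
proof (rule bij_imp_permutes)
  have "bij_betw (enumerate S \<circ> b \<circ> rank S) S S"
  proof (intro bij_betw_trans)
    show "bij_betw (enumerate S) {..<card S} S" by (rule finite_bij_enumerate[OF assms(1)])
    show "bij_betw b {..<card S} {..<card S}" by (rule permutes_imp_bij[OF assms(2)])
    show "bij_betw (rank S) S {..<card S}"
      by (rule bij_betw_byWitness[where f' = "enumerate S"])
        (use assms in \<open>auto simp: enumerate_rank rank_enumerate finite_enumerate_in_set\<close>)
  qed
  moreover have "bij_betw (lift_perm S b) S S \<longleftrightarrow> bij_betw (enumerate S \<circ> b \<circ> rank S) S S"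
    by (intro bij_betw_cong) (simp add: lift_perm_def)
  ultimately show "bij_betw (lift_perm S b) S S" by simp
qed (simp add: lift_perm_def)

text \<open>If \<open>b\<close> is the core of \<open>\<beta>\<close>, then \<open>dual m b\<close> is the core of \<open>\<alpha> = \<zeta>\<^sub>n \<beta>\<^sup>-\<^sup>1\<close>.\<close>

definition dual :: "nat \<Rightarrow> (nat \<Rightarrow> nat) \<Rightarrow> nat \<Rightarrow> nat" where
  "dual m b = cyc m \<circ> inv b"

lemma dual_permutes: "b permutes {..<m} \<Longrightarrow> dual m b permutes {..<m}"
  unfolding dual_def by (intro permutes_compose permutes_inv cyc_permutes)

lemma dual_comp: "b permutes {..<m} \<Longrightarrow> dual m b (b i) = cyc m i"
  by (simp add: dual_def permutes_inverses)

text \<open>The exceptional point \<open>x\<close> is the last entry of the trivial cycle, the one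
  that returns to the first entry; all other entries go to their cyclic successor.\<close>

lemma has_trivial_cycle_iff:
  assumes \<alpha>: "\<alpha> permutes {1..n}"
  shows "has_trivial_cycle n \<alpha> \<longleftrightarrow> (\<exists>x\<in>{1..n}. \<forall>y\<in>orbit \<alpha> x. y \<noteq> x \<longrightarrow> \<alpha> y = zeta n y)"
proof
  assume "has_trivial_cycle n \<alpha>"
  then obtain i p where i: "i \<in> {1..n}" and p: "p < n"
    and step: "\<And>j. j < p \<Longrightarrow> \<alpha> ((zeta n ^^ j) i) = (zeta n ^^ Suc j) i"
    and last: "\<alpha> ((zeta n ^^ p) i) = i"
    unfolding has_trivial_cycle_def by blast
  define x where "x = (zeta n ^^ p) i"
  define T where "T = (\<lambda>t. (zeta n ^^ t) i) ` {..p}"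
  have \<alpha>T: "\<alpha> y \<in> T" if "y \<in> T" for y
  proof -
    from that obtain t where t: "t \<le> p" "y = (zeta n ^^ t) i" by (auto simp: T_def)
    show ?thesis
    proof (cases "t = p")
      case True
      then show ?thesis using last t by (auto simp: T_def intro!: image_eqI[of _ _ 0])
    next
      case False
      then show ?thesis using step[of t] t by (auto simp: T_def intro!: image_eqI[of _ _ "Suc t"])
    qed
  qed
  have "orbit \<alpha> x \<subseteq> T"
  proof
    fix y assume "y \<in> orbit \<alpha> x"
    then show "y \<in> T"
      by induction (use \<alpha>T in \<open>auto simp: x_def T_def\<close>)
  qed
  moreover have "\<alpha> y = zeta n y" if "y \<in> T" "y \<noteq> x" for y
  proof -
    from that obtain t where t: "t \<le> p" "y = (zeta n ^^ t) i" by (auto simp: T_def)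
    then have "t < p" using that(2) by (cases "t = p") (auto simp: x_def)
    then show ?thesis using step[of t] t by simp
  qed
  moreover have "x \<in> {1..n}"
    unfolding x_def using i permutes_in_funpow_image[OF zeta_permutes] by blast
  ultimately show "\<exists>x\<in>{1..n}. \<forall>y\<in>orbit \<alpha> x. y \<noteq> x \<longrightarrow> \<alpha> y = zeta n y" by blast
next
  assume "\<exists>x\<in>{1..n}. \<forall>y\<in>orbit \<alpha> x. y \<noteq> x \<longrightarrow> \<alpha> y = zeta n y"
  then obtain x where x: "x \<in> {1..n}" and nx: "\<And>y. y \<in> orbit \<alpha> x \<Longrightarrow> y \<noteq> x \<Longrightarrow> \<alpha> y = zeta n y"
    by blast
  \<comment> \<open>The cycle is read off starting at \<open>\<alpha> x\<close>; \<open>p\<close> is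
    the first time at which it arrives at \<open>x\<close>. Up to then \<alpha> agrees with
    \<open>zeta n\<close>.\<close>
  define p where "p = (LEAST q. (\<alpha> ^^ q) (\<alpha> x) = x)"
  have "x \<in> orbit \<alpha> x" using permutes_self_in_orbit[OF \<alpha>] by simp
  then obtain q where "0 < q" "x = (\<alpha> ^^ q) x" unfolding orbit_altdef by blast
  then have "(\<alpha> ^^ (q - 1)) (\<alpha> x) = x" by (cases q) (simp_all add: funpow_swap1)
  then have p: "(\<alpha> ^^ p) (\<alpha> x) = x" unfolding p_def by (rule LeastI)
  have least: "(\<alpha> ^^ j) (\<alpha> x) \<noteq> x" if "j < p" for j
    using not_less_Least that unfolding p_def by blast
  have pow_orbit: "(\<alpha> ^^ j) (\<alpha> x) \<in> orbit \<alpha> x" for j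
    by (induction j) (auto intro: orbit.intros)
  have zpow: "(zeta n ^^ j) (\<alpha> x) = (\<alpha> ^^ j) (\<alpha> x)" if "j \<le> p" for j
    using that
  proof (induction j)
    case (Suc j)
    then show ?case using nx[OF pow_orbit[of j] least[of j]] by simp
  qed simp
  have "inj_on (\<lambda>j. (\<alpha> ^^ j) (\<alpha> x)) {..p}"
  proof (rule linorder_inj_onI)
    fix i j assume ij: "i < j" "i \<in> {..p}" "j \<in> {..p}"
    show "(\<alpha> ^^ i) (\<alpha> x) \<noteq> (\<alpha> ^^ j) (\<alpha> x)"
    proof
      assume "(\<alpha> ^^ i) (\<alpha> x) = (\<alpha> ^^ j) (\<alpha> x)"
      then have "(\<alpha> ^^ (p - j)) ((\<alpha> ^^ i) (\<alpha> x)) = (\<alpha> ^^ (p - j)) ((\<alpha> ^^ j) (\<alpha> x))" by simp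
      then have "(\<alpha> ^^ (p - j + i)) (\<alpha> x) = (\<alpha> ^^ (p - j + j)) (\<alpha> x)"
        by (simp only: funpow_add o_apply)
      moreover have "p - j + i < p" "p - j + j = p" using ij by auto
      ultimately show False using least[of "p - j + i"] p by simp
    qed
  qed auto
  then have "card ((\<lambda>j. (\<alpha> ^^ j) (\<alpha> x)) ` {..p}) = Suc p" by (simp add: card_image)
  moreover have "(\<lambda>j. (\<alpha> ^^ j) (\<alpha> x)) ` {..p} \<subseteq> {1..n}"
    using pow_orbit permutes_orbit_subset[OF \<alpha> x] by blast
  ultimately have "Suc p \<le> n" by (metis card_mono finite_atLeastAtMost card_atLeastAtMost diff_Suc_1)
  moreover have "\<alpha> ((zeta n ^^ p) (\<alpha> x)) = \<alpha> x" using zpow[of p] p by simp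
  moreover have "\<alpha> ((zeta n ^^ j) (\<alpha> x)) = (zeta n ^^ Suc j) (\<alpha> x)" if "j < p" for j
    using that zpow[of j] zpow[of "Suc j"] by simp
  moreover have "\<alpha> x \<in> {1..n}" using x permutes_in_image[OF \<alpha>] by blast
  ultimately show "has_trivial_cycle n \<alpha>"
    unfolding has_trivial_cycle_def by (auto intro!: bexI[of _ "\<alpha> x"] exI[of _ p])
qed

text \<open>A fixed point of \<beta> is a vertex of degree one of the one-face map. Passing from the
  core to \<open>n\<close> points inserts such leaves at the positions outside
  \<open>S\<close>.\<close>

locale leaf_insertion =
  fixes n :: nat and S :: "nat set" and b :: "nat \<Rightarrow> nat"
  assumes S: "S \<subseteq> {1..n}" and b: "b permutes {..<card S}"
begin

abbreviation "m \<equiv> card S"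
abbreviation "e \<equiv> enumerate S"
abbreviation "\<beta> \<equiv> lift_perm S b"
abbreviation "a \<equiv> dual m b"

definition "\<alpha> = zeta n \<circ> inv \<beta>"

lemma finS: "finite S" using S finite_subset by blast

lemma \<beta>: "\<beta> permutes S" by (rule lift_perm_permutes[OF finS b])

lemma \<beta>n: "\<beta> permutes {1..n}" using permutes_subset[OF \<beta> S] .

lemma \<alpha>: "\<alpha> permutes {1..n}"
  unfolding \<alpha>_def by (intro permutes_compose permutes_inv zeta_permutes \<beta>n)

lemma a: "a permutes {..<m}" by (rule dual_permutes[OF b])

lemma \<alpha>_\<beta>: "\<alpha> (\<beta> x) = zeta n x"
  using permutes_inverses[OF \<beta>] by (simp add: \<alpha>_def)

lemma inv_\<alpha>_zeta: "inv \<alpha> \<circ> zeta n = \<beta>"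
  unfolding \<alpha>_def using permutes_inverses[OF zeta_permutes] permutes_inverses[OF \<beta>n]
  by (subst o_inv_distrib) (auto simp: permutes_bij[OF zeta_permutes] permutes_bij[OF permutes_inv[OF \<beta>n]]
      fun_eq_iff inv_inv_eq permutes_bij[OF \<beta>n])

lemma \<alpha>_out: "z \<notin> S \<Longrightarrow> \<alpha> z = zeta n z"
  using \<alpha>_\<beta>[of z] by (simp add: lift_perm_def)

lemma \<alpha>_in: "j < m \<Longrightarrow> \<alpha> (e (b j)) = zeta n (e j)"
  using \<alpha>_\<beta>[of "e j"] lift_perm_enumerate[OF finS] by simp

lemma e_mem: "i < m \<Longrightarrow> e i \<in> {1..n}" using finite_enumerate_in_set[OF finS] S by blast

text \<open>Outside \<open>S\<close> the map \<alpha> follows \<open>zeta n\<close>, so the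
  trajectory of \<open>z\<close> first meets \<open>S\<close> in the cyclically next element.
  Reduction modulo \<open>m\<close> treats the points above \<open>Max S\<close>, for which this is
  the least element.\<close>

definition "N z = rank S z mod m"

lemma N_e: "i < m \<Longrightarrow> N (e i) = i"
  by (simp add: N_def rank_enumerate[OF finS])

lemma rank_1: "rank S (Suc 0) = 0"
proof -
  have "{s \<in> S. s < Suc 0} = {}" using S by auto
  then show ?thesis unfolding rank_def by simp
qed

lemma rank_n: "rank S (Suc n) = m"
proof -
  have "{s \<in> S. s < Suc n} = S" using S by auto
  then show ?thesis unfolding rank_def by simp
qed

lemma N_zeta:
  assumes "z \<in> {1..n}"
  shows "N (zeta n z) = (if z \<in> S then Suc (rank S z) mod m else N z)"
proof (cases "z = n")
  case True
  then have "rank S z + (if z \<in> S then 1 else 0) = m" using rank_n rank_Suc[OF finS, of z] by simp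
  then show ?thesis using True assms rank_1 by (auto simp: N_def zeta_apply)
next
  case False
  then show ?thesis using assms rank_Suc[OF finS, of z] by (auto simp: N_def zeta_apply)
qed

text \<open>This identifies the core of \<alpha>: the point with index \<open>b j\<close> goes to
  the successor of \<open>e j\<close>, from where the next element of \<open>S\<close> has index
  \<open>j + 1\<close> modulo \<open>m\<close>, and that is \<open>dual m b (b j)\<close>.\<close>

lemma N_\<alpha>_in:
  assumes "i < m" shows "N (\<alpha> (e i)) = a i"
proof -
  obtain j where j: "j < m" "b j = i"
    using permutes_image[OF b] assms by (metis imageE lessThan_iff)
  then have "N (\<alpha> (e i)) = Suc j mod m"
    using \<alpha>_in[OF j(1)] N_zeta[OF e_mem[OF j(1)]] finite_enumerate_in_set[OF finS j(1)]
    by (simp add: rank_enumerate[OF finS])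
  then show ?thesis using dual_comp[OF b, of j] j by (simp add: cyc_def)
qed

lemma e_N_orbit:
  assumes "S \<noteq> {}" "z \<in> {1..n}"
  shows "e (N z) \<in> orbit \<alpha> z"
proof -
  have mpos: "0 < m" using assms finS by (simp add: card_gt_0_iff)
  have inS: "e (N z) \<in> orbit \<alpha> z" if "z \<in> S" for z
    using that enumerate_rank[OF finS that] permutes_self_in_orbit[OF \<alpha>] by (simp add: N_def)
  have step: "e (N z) \<in> orbit \<alpha> z" if "z \<in> {1..n}" "z \<notin> S" "e (N (zeta n z)) \<in> orbit \<alpha> (zeta n z)" for z
  proof -
    have "\<alpha> z \<in> orbit \<alpha> z" by (rule orbit.base)
    then show ?thesis using that \<alpha>_out[OF that(2)] N_zeta[OF that(1)] orbit_trans by metis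
  qed
  \<comment> \<open>Up to \<open>Max S\<close> the walk to the next element of \<open>S\<close> does
    not wrap around. The induction below reduces the step from \<open>n\<close> to 1 to this
    case.\<close>
  have low: "z \<in> {1..n} \<Longrightarrow> z \<le> Max S \<Longrightarrow> e (N z) \<in> orbit \<alpha> z" for z
  proof (induction "Max S - z" arbitrary: z rule: less_induct)
    case less
    show ?case
    proof (cases "z \<in> S")
      case False
      then have "z < Max S" using less(3) assms(1) finS by (metis Max_in le_neq_implies_less)
      moreover have "Max S \<le> n" using S assms(1) finS by (metis Max_in atLeastAtMost_iff subsetD)
      ultimately have "zeta n z = Suc z" "Suc z \<in> {1..n}" "Suc z \<le> Max S"
        using less(2) by (auto simp: zeta_apply)
      then show ?thesis using step[OF less(2) False] less(1)[of "Suc z"] \<open>z < Max S\<close> by simp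
    qed (rule inS)
  qed
  have "e (N z) \<in> orbit \<alpha> z" if "z \<in> {1..n}" for z
    using that
  proof (induction "n - z" arbitrary: z rule: less_induct)
    case less
    show ?case
    proof (cases "z \<in> S")
      case False
      show ?thesis
      proof (cases "z = n")
        case True
        have "1 \<le> Max S" using S assms(1) finS by (metis Max_in atLeastAtMost_iff subsetD)
        then show ?thesis using step[OF less(2) False] low[of 1] True less(2) by (auto simp: zeta_apply)
      next
        case nn: False
        then show ?thesis using step[OF less(2) False] less(1)[of "Suc z"] less(2) by (auto simp: zeta_apply)
      qed
    qed (rule inS)
  qed
  then show ?thesis using assms by blast
qed

lemma first_return_\<alpha>:
  assumes "S \<noteq> {}"
  shows "first_return \<alpha> {1..n} a {..<m} N e"
proof
  have mpos: "0 < m" using assms finS by (simp add: card_gt_0_iff)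
  fix z
  show "z \<in> {1..n} \<Longrightarrow> N z \<in> {..<m}" using mpos by (simp add: N_def)
  show "z \<in> {1..n} \<Longrightarrow> z \<notin> e ` {..<m} \<Longrightarrow> N (\<alpha> z) = N z"
    using \<alpha>_out N_zeta by (simp add: enumerate_image[OF finS])
  show "z \<in> {1..n} \<Longrightarrow> e (N z) \<in> orbit \<alpha> z" by (rule e_N_orbit[OF assms])
qed (use \<alpha> a e_mem N_e N_\<alpha>_in in auto)

lemma first_return_\<beta>: "first_return \<beta> S b {..<m} (rank S) e"
proof
  show "i \<in> {..<m} \<Longrightarrow> rank S (\<beta> (e i)) = b i" for i
    using permutes_in_image[OF b] lift_perm_enumerate[OF finS] by (simp add: rank_enumerate[OF finS])
  show "z \<in> S \<Longrightarrow> e (rank S z) \<in> orbit \<beta> z" for z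
    using enumerate_rank[OF finS] permutes_self_in_orbit[OF \<beta> finS] by simp
qed (use \<beta> b finS in \<open>auto simp: enumerate_rank rank_enumerate finite_enumerate_in_set enumerate_image\<close>)

lemma num_cycles_\<alpha>: "S \<noteq> {} \<Longrightarrow> num_cycles n \<alpha> = card (orbit a ` {..<m})"
  unfolding num_cycles_def by (rule first_return.card_orbits[OF first_return_\<alpha>])

text \<open>The extra \<open>n - m\<close> cycles balance the change from \<open>n\<close> to
  \<open>m\<close> in the genus equation.\<close>

lemma num_cycles_\<beta>: "num_cycles n \<beta> = card (orbit b ` {..<m}) + (n - m)"
proof -
  have "orbit \<beta> x = {x}" if "x \<notin> S" for x
    using that permutes_not_in[OF \<beta>] by (simp add: orbit_eq_singleton_iff)
  then have out: "orbit \<beta> ` ({1..n} - S) = (\<lambda>x. {x}) ` ({1..n} - S)" by simp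
  have "orbit \<beta> ` {1..n} = orbit \<beta> ` S \<union> (\<lambda>x. {x}) ` ({1..n} - S)"
    unfolding out[symmetric] image_Un[symmetric] using S by (simp add: Un_absorb1)
  moreover have "orbit \<beta> ` S \<inter> (\<lambda>x. {x}) ` ({1..n} - S) = {}"
    using permutes_orbit_subset[OF \<beta>] by auto
  ultimately have "num_cycles n \<beta> = card (orbit \<beta> ` S) + card ((\<lambda>x. {x}) ` ({1..n} - S))"
    unfolding num_cycles_def using finS by (simp add: card_Un_disjoint)
  then show ?thesis
    using first_return.card_orbits[OF first_return_\<beta>] S finS
    by (simp add: card_image card_Diff_subset)
qed

text \<open>As \<open>b\<close> has no fixed point, \<open>S\<close> is exactly the set where
  \<alpha> differs from \<open>zeta n\<close>, so a cycle is trivial iff it has at most one point in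
  \<open>S\<close>. Every cycle of \<alpha> meets \<open>S\<close>, and meeting it once means a
  fixed point of the first return map \<open>a\<close>.\<close>

lemma reduced_iff:
  assumes "S \<noteq> {}" and bf: "\<And>i. i < m \<Longrightarrow> b i \<noteq> i"
  shows "reduced n \<alpha> \<longleftrightarrow> (\<forall>i<m. a i \<noteq> i)"
proof -
  interpret fr: first_return \<alpha> "{1..n}" a "{..<m}" N e by (rule first_return_\<alpha>[OF assms(1)])
  have in_S: "\<alpha> y \<noteq> zeta n y" if yS: "y \<in> S" for y
  proof -
    have "\<beta> y \<noteq> y"
    proof
      assume "\<beta> y = y"
      moreover obtain i where "i < m" "y = e i" using enumerate_rank[OF finS yS] by metis
      ultimately show False using bf[of i] lift_perm_enumerate[OF finS, of i b]
          rank_enumerate[OF finS] permutes_in_image[OF b] by (metis lessThan_iff)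
    qed
    then show ?thesis using \<alpha>_\<beta>[of y] permutes_inj[OF \<alpha>] by (metis injD)
  qed
  have "has_trivial_cycle n \<alpha> \<longleftrightarrow> (\<exists>x\<in>{1..n}. orbit \<alpha> x \<inter> S \<subseteq> {x})"
    unfolding has_trivial_cycle_iff[OF \<alpha>] using in_S \<alpha>_out by blast
  also have "\<dots> \<longleftrightarrow> (\<exists>x\<in>{1..n}. e ` orbit a (N x) \<subseteq> {x})"
    using fr.orbit_Int by (simp add: enumerate_image[OF finS])
  also have "\<dots> \<longleftrightarrow> (\<exists>i<m. a i = i)"
  proof
    assume "\<exists>x\<in>{1..n}. e ` orbit a (N x) \<subseteq> {x}"
    then obtain x where x: "x \<in> {1..n}" "e ` orbit a (N x) \<subseteq> {x}" by blast
    have N: "N x \<in> {..<m}" using fr.N_in[OF x(1)] .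
    have "N x \<in> orbit a (N x)" "a (N x) \<in> orbit a (N x)"
      using permutes_self_in_orbit[OF a] by (auto intro: orbit.base)
    then have "e (N x) = x" "e (a (N x)) = x" using x(2) by blast+
    then have "e (N x) = e (a (N x))" by simp
    then have "a (N x) = N x" using N_e N permutes_in_image[OF a] by (metis lessThan_iff)
    then show "\<exists>i<m. a i = i" using N by auto
  next
    assume "\<exists>i<m. a i = i"
    then obtain i where "i < m" "a i = i" by blast
    then have "orbit a (N (e i)) = {i}" using orbit_eq_singleton_iff N_e by metis
    then show "\<exists>x\<in>{1..n}. e ` orbit a (N x) \<subseteq> {x}" using e_mem[OF \<open>i < m\<close>] by (auto intro!: bexI[of _ "e i"])
  qed
  finally show ?thesis unfolding reduced_def by blast
qed

end

section \<open>Back points under the deletion\<close>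

definition core_back_points :: "nat \<Rightarrow> (nat \<Rightarrow> nat) \<Rightarrow> nat set" where
  "core_back_points m a = {i \<in> {..<m}. a i < i \<and> a i \<noteq> Min (orbit a i)}"

text \<open>Minimality without \<open>Min\<close>, in a form that can be transported along a first
  return map.\<close>

lemma eq_Min_orbit_iff:
  fixes f :: "nat \<Rightarrow> nat"
  assumes "f permutes A" "finite A" "x \<in> A"
  shows "f x = Min (orbit f x) \<longleftrightarrow> \<not> (\<exists>y\<in>orbit f x. y < f x)"
proof -
  have "finite (orbit f x)" using permutes_orbit_subset[OF assms(1,3)] assms(2) finite_subset by blast
  moreover have "f x \<in> orbit f x" by (rule orbit.base)
  ultimately have "Min (orbit f x) = f x \<longleftrightarrow> (\<forall>y\<in>orbit f x. f x \<le> y)"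
    by (subst Min_eq_iff) auto
  then show ?thesis by (auto simp: not_less)
qed

context leaf_insertion
begin

text \<open>A point outside \<open>S\<close> goes to its successor, or from \<open>n\<close> to 1,
  and is never a back point. For \<open>i = b j\<close> with \<open>j + 1 < m\<close> the value of
  \<alpha> at \<open>e i\<close> is \<open>e j + 1\<close>, which lies above \<open>e j\<close> and
  not above \<open>e (j + 1)\<close>. As \<open>e\<close> is increasing, the comparisons for
  \<open>e i\<close> and for \<open>i\<close> agree, once the absence of fixed points has excluded
  equalities.\<close>

lemma card_back_points:
  assumes "S \<noteq> {}" and bf: "\<And>i. i < m \<Longrightarrow> b i \<noteq> i" and af: "\<And>i. i < m \<Longrightarrow> a i \<noteq> i"
  shows "card (back_points n \<alpha>) = card (core_back_points m a)"
proof -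
  interpret fr: first_return \<alpha> "{1..n}" a "{..<m}" N e by (rule first_return_\<alpha>[OF assms(1)])
  have low: "\<alpha> z \<noteq> 1" if "z \<in> back_points n \<alpha>" for z
    using that eq_Min_orbit_iff[OF \<alpha> _, of z] permutes_orbit_subset[OF \<alpha>, of z]
    by (fastforce simp: back_points_def)
  have sub: "back_points n \<alpha> \<subseteq> e ` {..<m}"
  proof
    fix z assume z: "z \<in> back_points n \<alpha>"
    have "z \<in> S"
    proof (rule ccontr)
      assume "z \<notin> S"
      then have "\<alpha> z = zeta n z" by (rule \<alpha>_out)
      moreover have "z \<in> {1..n}" "\<alpha> z < z" using z by (auto simp: back_points_def)
      ultimately show False using low[OF z] zeta_apply[of z n] by (auto split: if_splits)
    qed
    then show "z \<in> e ` {..<m}" by (simp add: enumerate_image[OF finS])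
  qed
  have iff: "e i \<in> back_points n \<alpha> \<longleftrightarrow> i \<in> core_back_points m a" if i: "i < m" for i
  proof -
    obtain j where j: "j < m" "b j = i"
      using permutes_image[OF b] i by (metis imageE lessThan_iff)
    have ai: "a i = Suc j mod m" using dual_comp[OF b, of j] j by (simp add: cyc_def)
    have \<alpha>i: "\<alpha> (e i) = zeta n (e j)" using \<alpha>_in[OF j(1)] j by simp
    have ei: "e i \<in> {1..n}" and ej: "e j \<in> {1..n}" using e_mem i j by auto
    have "j \<noteq> i" using bf[OF j(1)] j(2) by auto
    show ?thesis
    proof (cases "Suc j = m")
      \<comment> \<open>Wrap-around: \<open>a i = 0\<close> is minimal, while \<alpha> sends
        \<open>e i\<close> to 1 or to the successor of \<open>e j\<close>, the largest element of
        \<open>S\<close>.\<close>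
      case True
      have "a i = 0" using ai True by simp
      then have "i \<notin> core_back_points m a"
        using eq_Min_orbit_iff[OF a, of i] i by (simp add: core_back_points_def)
      moreover have "e i \<notin> back_points n \<alpha>"
      proof
        assume bp: "e i \<in> back_points n \<alpha>"
        then have "\<alpha> (e i) = Suc (e j)" using low[OF bp] \<alpha>i ej by (auto simp: zeta_apply split: if_splits)
        then have "e j < e i" using bp by (simp add: back_points_def)
        then have "j < i" using i j finS by simp
        then show False using i True by simp
      qed
      ultimately show ?thesis by simp
    next
      case False
      then have Sj: "Suc j < m" using j by simp
      then have ai: "a i = Suc j" using ai by simp
      have "e j < e (Suc j)" using Sj finS by simp
      then have "e j < n" using e_mem[OF Sj] by simp
      then have \<alpha>i: "\<alpha> (e i) = Suc (e j)" using \<alpha>i ej by (simp add: zeta_apply)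
      have "Suc j \<noteq> i" using af[OF i] ai by simp
      have "\<alpha> (e i) \<noteq> e i" using N_\<alpha>_in[OF i] N_e[OF i] af[OF i] by metis
      then have "Suc (e j) \<noteq> e i" using \<alpha>i by simp
      have "Suc (e j) < e i \<longleftrightarrow> e j < e i" using \<open>Suc (e j) \<noteq> e i\<close> by linarith
      also have "\<dots> \<longleftrightarrow> j < i" using i j finS by simp
      also have "\<dots> \<longleftrightarrow> Suc j < i" using \<open>Suc j \<noteq> i\<close> by linarith
      finally have less: "\<alpha> (e i) < e i \<longleftrightarrow> a i < i" using ai \<alpha>i by simp
      have "(\<exists>y\<in>orbit \<alpha> (e i). y < \<alpha> (e i)) \<longleftrightarrow> (\<exists>x\<in>orbit a i. x < a i)"
      proof
        assume "\<exists>y\<in>orbit \<alpha> (e i). y < \<alpha> (e i)"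
        then obtain y where y: "y \<in> orbit \<alpha> (e i)" "y \<le> e j" using \<alpha>i by auto
        have "N y \<in> orbit a i" using fr.N_orbit[OF ei y(1)] N_e[OF i] by simp
        moreover have "rank S y \<le> j"
          using rank_mono[OF finS y(2)] rank_enumerate[OF finS j(1)] by simp
        then have "N y < a i" using ai j(1) by (simp add: N_def)
        ultimately show "\<exists>x\<in>orbit a i. x < a i" by blast
      next
        assume "\<exists>x\<in>orbit a i. x < a i"
        then obtain x where x: "x \<in> orbit a i" "x \<le> j" using ai by auto
        have "e x \<in> orbit \<alpha> (e i)" using fr.e_orbit[OF ei] x(1) N_e[OF i] by simp
        moreover have "e x \<le> e j"
          using x(2) j(1) finS finite_enumerate_mono[of x j S] by (auto simp: le_less)
        then have "e x < \<alpha> (e i)" using \<alpha>i by simp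
        ultimately show "\<exists>y\<in>orbit \<alpha> (e i). y < \<alpha> (e i)" by blast
      qed
      then show ?thesis
        using less eq_Min_orbit_iff[OF a, of i] eq_Min_orbit_iff[OF \<alpha> _ ei] i ei
        by (simp add: core_back_points_def back_points_def)
    qed
  qed
  have "back_points n \<alpha> = e ` core_back_points m a"
    using sub iff by (auto simp: core_back_points_def)
  moreover have "inj_on e (core_back_points m a)"
    by (rule inj_on_subset[OF bij_betw_imp_inj_on[OF finite_bij_enumerate[OF finS]]])
      (auto simp: core_back_points_def)
  ultimately show ?thesis by (simp add: card_image)
qed

end

text \<open>The last condition is genus one: \<open>m + 1 - 2 = z(dual m b) + z(b)\<close>.\<close>

definition core :: "nat \<Rightarrow> nat \<Rightarrow> (nat \<Rightarrow> nat) set" where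
  "core m k = {b. b permutes {..<m} \<and> (\<forall>i<m. b i \<noteq> i) \<and> (\<forall>i<m. dual m b i \<noteq> i) \<and>
     card (orbit (dual m b) ` {..<m}) = k \<and> card (orbit b ` {..<m}) + k + 1 = m}"

section \<open>Reduced permutations as pairs of a point set and a core\<close>

definition expand :: "nat \<Rightarrow> nat set \<times> (nat \<Rightarrow> nat) \<Rightarrow> nat \<Rightarrow> nat" where
  "expand n = (\<lambda>(S, b). zeta n \<circ> inv (lift_perm S b))"

lemma genus_eq_one_iff:
  "genus n \<alpha> = 1 \<longleftrightarrow> num_cycles n \<alpha> + num_cycles n (inv \<alpha> \<circ> zeta n) + 1 = n"
proof -
  have "genus n \<alpha> = 1 \<longleftrightarrow>
    rat_of_nat (num_cycles n \<alpha> + num_cycles n (inv \<alpha> \<circ> zeta n) + 1) = rat_of_nat n"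
    unfolding genus_def by (auto simp: field_simps)
  then show ?thesis unfolding of_nat_eq_iff .
qed

lemma card_back_points_expand:
  assumes "S \<subseteq> {1..n}" "b \<in> core (card S) k"
  shows "card (back_points n (expand n (S, b))) = card (core_back_points (card S) (dual (card S) b))"
proof -
  interpret leaf_insertion n S b by unfold_locales (use assms in \<open>auto simp: core_def\<close>)
  have "S \<noteq> {}" using assms by (auto simp: core_def)
  then show ?thesis
    using card_back_points assms by (auto simp: core_def expand_def \<alpha>_def)
qed

lemma expand_mem:
  assumes "S \<subseteq> {1..n}" "b \<in> core (card S) k"
  shows "expand n (S, b) \<in> reduced_genus_one n k"
proof -
  interpret leaf_insertion n S b by unfold_locales (use assms in \<open>auto simp: core_def\<close>)
  have eq: "expand n (S, b) = \<alpha>" by (simp add: expand_def \<alpha>_def)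
  have "S \<noteq> {}" using assms by (auto simp: core_def)
  moreover have "m \<le> n" using card_mono[OF _ assms(1)] by simp
  ultimately show ?thesis unfolding eq reduced_genus_one_def
    using assms(2) \<alpha> reduced_iff num_cycles_\<alpha> num_cycles_\<beta>
    by (auto simp: genus_eq_one_iff inv_\<alpha>_zeta core_def)
qed

text \<open>The lift of \<open>b\<close> is recovered as \<open>inv \<alpha> \<circ> zeta n\<close>;
  its moved points form \<open>S\<close>, and ranks in \<open>S\<close> give back
  \<open>b\<close>.\<close>

lemma inj_on_expand: "inj_on (expand n) (SIGMA S:Pow {1..n}. core (card S) k)"
proof (rule inj_onI, clarify)
  fix S b T c
  assume S: "S \<subseteq> {1..n}" "b \<in> core (card S) k" and T: "T \<subseteq> {1..n}" "c \<in> core (card T) k"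
    and eq: "expand n (S, b) = expand n (T, c)"
  interpret s: leaf_insertion n S b by unfold_locales (use S in \<open>auto simp: core_def\<close>)
  interpret t: leaf_insertion n T c by unfold_locales (use T in \<open>auto simp: core_def\<close>)
  have "s.\<alpha> = t.\<alpha>" using eq by (simp add: expand_def s.\<alpha>_def t.\<alpha>_def)
  then have lift: "lift_perm S b = lift_perm T c" using s.inv_\<alpha>_zeta t.inv_\<alpha>_zeta by simp
  have supp: "S = {x. lift_perm S b x \<noteq> x}" if "leaf_insertion n S b" "b \<in> core (card S) k" for S b
  proof -
    interpret leaf_insertion n S b by fact
    have "lift_perm S b x \<noteq> x" if x: "x \<in> S" for x
    proof -
      have r: "rank S x < card S" using enumerate_rank[OF finS x] by simp
      then have "b (rank S x) \<noteq> rank S x" using \<open>b \<in> core (card S) k\<close> by (simp add: core_def)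
      moreover have "b (rank S x) < card S" using r permutes_in_image[OF b] by simp
      ultimately show ?thesis
        using rank_enumerate[OF finS] x unfolding lift_perm_def by metis
    qed
    then show ?thesis by (auto simp: lift_perm_def)
  qed
  have ST: "S = T"
    using supp[OF s.leaf_insertion_axioms S(2)] supp[OF t.leaf_insertion_axioms T(2)] lift by metis
  moreover have "b = c"
  proof
    fix i
    show "b i = c i"
    proof (cases "i < card S")
      case True
      then have "enumerate S (b i) = enumerate S (c i)"
        using lift ST lift_perm_enumerate[OF s.finS True] by metis
      moreover have "b i < card S" "c i < card S"
        using permutes_in_image[OF s.b] permutes_in_image[OF t.b] True ST by auto
      ultimately show ?thesis using rank_enumerate[OF s.finS] by metis
    next
      case False
      then show ?thesis using permutes_not_in[OF s.b] permutes_not_in[OF t.b] ST by simp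
    qed
  qed
  ultimately show "S = T \<and> b = c" by simp
qed

lemma expand_surj:
  assumes "\<gamma> \<in> reduced_genus_one n k"
  shows "\<gamma> \<in> expand n ` (SIGMA S:Pow {1..n}. core (card S) k)"
proof -
  have \<gamma>: "\<gamma> permutes {1..n}" and "reduced n \<gamma>" and "genus n \<gamma> = 1" and "num_cycles n \<gamma> = k"
    using assms by (auto simp: reduced_genus_one_def)
  define \<delta> where "\<delta> = inv \<gamma> \<circ> zeta n"
  have \<delta>n: "\<delta> permutes {1..n}"
    unfolding \<delta>_def by (intro permutes_compose permutes_inv zeta_permutes \<gamma>)
  define S where "S = {x \<in> {1..n}. \<delta> x \<noteq> x}"
  have S: "S \<subseteq> {1..n}" by (auto simp: S_def)
  then have finS: "finite S" using finite_subset by blast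
  have \<delta>: "\<delta> permutes S"
    using \<delta>n permutes_superset[OF \<delta>n, of S] by (auto simp: S_def)
  define b where "b i = (if i < card S then rank S (\<delta> (enumerate S i)) else i)" for i
  have "bij_betw (rank S \<circ> \<delta> \<circ> enumerate S) {..<card S} {..<card S}"
  proof (intro bij_betw_trans)
    show "bij_betw (enumerate S) {..<card S} S" by (rule finite_bij_enumerate[OF finS])
    show "bij_betw \<delta> S S" by (rule permutes_imp_bij[OF \<delta>])
    show "bij_betw (rank S) S {..<card S}"
      by (rule bij_betw_byWitness[where f' = "enumerate S"])
        (use finS in \<open>auto simp: enumerate_rank rank_enumerate finite_enumerate_in_set\<close>)
  qed
  moreover have "bij_betw b {..<card S} {..<card S} \<longleftrightarrow>
      bij_betw (rank S \<circ> \<delta> \<circ> enumerate S) {..<card S} {..<card S}"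
    by (intro bij_betw_cong) (simp add: b_def)
  ultimately have b: "b permutes {..<card S}" by (intro bij_imp_permutes) (auto simp: b_def)
  interpret leaf_insertion n S b by unfold_locales (use S b in auto)
  have lift: "lift_perm S b = \<delta>"
  proof
    fix x
    show "lift_perm S b x = \<delta> x"
      using permutes_not_in[OF \<delta>] permutes_in_image[OF \<delta>]
      by (simp add: lift_perm_def b_def enumerate_rank[OF finS])
  qed
  have "\<gamma> (\<delta> x) = zeta n x" for x by (simp add: \<delta>_def permutes_inverses[OF \<gamma>])
  then have "\<gamma> x = \<alpha> x" for x
    using permutes_inverses[OF \<delta>] by (metis \<alpha>_\<beta> lift)
  then have \<gamma>\<alpha>: "\<gamma> = \<alpha>" by blast
  have cyc: "num_cycles n \<gamma> + num_cycles n \<delta> + 1 = n"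
    using \<open>genus n \<gamma> = 1\<close> unfolding genus_eq_one_iff \<delta>_def .
  have b_cycles: "num_cycles n \<delta> = card (orbit b ` {..<card S}) + (n - card S)"
    using num_cycles_\<beta> lift by simp
  have "card S \<le> n" using card_mono[OF _ S] by simp
  \<comment> \<open>Otherwise \<delta> would have \<open>n\<close> cycles, more than the genus
    equation permits.\<close>
  have "S \<noteq> {}" using cyc b_cycles by auto
  have bf: "b i \<noteq> i" if "i < card S" for i
  proof
    assume "b i = i"
    then have "\<delta> (enumerate S i) = enumerate S i" using lift lift_perm_enumerate[OF finS that, of b] by simp
    then show False using finite_enumerate_in_set[OF finS that] by (simp add: S_def)
  qed
  have "b \<in> core (card S) k"
    using b bf reduced_iff[OF \<open>S \<noteq> {}\<close> bf] \<open>reduced n \<gamma>\<close> \<gamma>\<alpha> num_cycles_\<alpha>[OF \<open>S \<noteq> {}\<close>]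
      \<open>num_cycles n \<gamma> = k\<close> cyc b_cycles \<open>card S \<le> n\<close>
    by (auto simp: core_def)
  moreover have "\<gamma> = expand n (S, b)" using \<gamma>\<alpha> by (simp add: expand_def \<alpha>_def)
  ultimately show ?thesis using S by blast
qed

lemma bij_betw_expand:
  "bij_betw (expand n) (SIGMA S:Pow {1..n}. core (card S) k) (reduced_genus_one n k)"
  using inj_on_expand expand_mem expand_surj by (intro bij_betw_imageI) auto

section \<open>Corner maps\<close>

text \<open>A finite set of residues modulo \<open>N\<close>, listed in increasing order and continued periodically, so
  that cyclic intervals between neighbouring residues become ordinary intervals.\<close>

locale periodic_seq =
  fixes K :: nat and N :: int and p :: "nat \<Rightarrow> int"
  assumes mono: "strict_mono p" and shift: "p (i + K) = p i + N"
    and range: "p ` {..<K} \<subseteq> {0..<N}" and K: "0 < K"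
begin

lemma shift_mult: "p (i + K * t) = p i + N * int t"
proof (induction t)
  case (Suc t)
  then show ?case using shift[of "i + K * t"] by (simp add: algebra_simps)
qed simp

lemma less_iff: "p i < p j \<longleftrightarrow> i < j" and le_iff: "p i \<le> p j \<longleftrightarrow> i \<le> j"
  and eq_iff: "p i = p j \<longleftrightarrow> i = j"
  using mono by (auto simp: strict_mono_less strict_mono_less_eq strict_mono_eq)

lemma p0: "0 \<le> p 0" "p 0 < N" using range K by auto

lemma p_nonneg: "0 \<le> p i" using p0 le_iff[of 0 i] by linarith

lemma p_mod: "p i mod N = p (i mod K)"
proof -
  have "p i = p (i mod K) + N * int (i div K)"
    using shift_mult[of "i mod K" "i div K"] by simp
  moreover have "p (i mod K) \<in> {0..<N}" using K by (intro subsetD[OF range]) auto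
  ultimately show ?thesis by simp
qed

lemma range_iff: "x \<in> Set.range p \<longleftrightarrow> 0 \<le> x \<and> x mod N \<in> p ` {..<K}"
proof
  assume "x \<in> Set.range p"
  then obtain i where "x = p i" by blast
  then show "0 \<le> x \<and> x mod N \<in> p ` {..<K}" using p_mod p_nonneg K by auto
next
  assume x: "0 \<le> x \<and> x mod N \<in> p ` {..<K}"
  then obtain i where "x mod N = p i" by auto
  then have "x = p i + N * int (nat (x div N))"
    using x p0 by (simp add: pos_imp_zdiv_nonneg_iff flip: minus_mod_eq_mult_div)
  then show "x \<in> Set.range p" using shift_mult[of i "nat (x div N)"] by (metis rangeI)
qed

lemma segment:
  assumes "p 0 \<le> x"
  obtains i where "p i \<le> x" "x < p (Suc i)"
proof -
  have "p i \<ge> int i" for i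
  proof (induction i)
    case (Suc i)
    then show ?case using less_iff[of i "Suc i"] by simp
  qed (simp add: p_nonneg)
  then have "x < p (Suc (nat x))" by (smt (verit, best) int_nat_eq of_nat_Suc)
  then have *: "x < p (LEAST i. x < p i)" by (rule LeastI)
  then obtain i where i: "(LEAST i. x < p i) = Suc i" using assms by (cases "LEAST i. x < p i") auto
  then have "p i \<le> x" using not_less_Least[of i "\<lambda>i. x < p i"] by auto
  then show ?thesis using that * i by auto
qed

lemma segment_length: "p (Suc i) \<le> p i + N"
  using shift[of i] K le_iff[of "Suc i" "i + K"] by auto

lemma segment_inside:
  assumes "0 < j" "j < p (Suc i) - p i"
  shows "(p i + j) mod N \<notin> p ` {..<K}"
proof
  assume "(p i + j) mod N \<in> p ` {..<K}"
  then have "p i + j \<in> Set.range p" using range_iff[of "p i + j"] p_nonneg[of i] assms by simp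
  then obtain t where "p i + j = p t" by blast
  then have "i < t" "t < Suc i" using assms less_iff[of i t] less_iff[of t "Suc i"] by auto
  then show False by simp
qed

end

text \<open>The ends of the segment around \<open>x\<close> are the neighbours of \<open>x\<close>
  in the common range, so they do not depend on the indexing, and \<open>K = L\<close> need not be
  known beforehand.\<close>

lemma periodic_seq_unique:
  assumes "periodic_seq K N p" "periodic_seq L N q" "p ` {..<K} = q ` {..<L}"
    and "p i \<le> x" "x < p (Suc i)" "q j \<le> x" "x < q (Suc j)"
  shows "p i = q j" "p (Suc i) = q (Suc j)"
proof -
  interpret p: periodic_seq K N p by fact
  interpret q: periodic_seq L N q by fact
  have r: "Set.range p = Set.range q" using p.range_iff q.range_iff assms(3) by blast
  obtain u v u' v' where uv: "p i = q u" "p (Suc i) = q v" "q j = p u'" "q (Suc j) = p v'"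
    using r by (metis rangeI rangeE)
  have "u < Suc j" "u' < Suc i" "j < v" "i < v'"
    using uv assms(4-7) p.less_iff[of u' "Suc i"] p.less_iff[of i v'] q.less_iff[of u "Suc j"] q.less_iff[of j v]
    by linarith+
  then show "p i = q j" "p (Suc i) = q (Suc j)"
    using uv p.le_iff[of u' i] p.le_iff[of "Suc i" v'] q.le_iff[of u j] q.le_iff[of "Suc j" v]
    by (auto simp: Suc_le_eq less_Suc_eq_le)
qed

lemma periodic_seq_exists:
  fixes X :: "int set"
  assumes "finite X" "X \<subseteq> {0..<N}" "X \<noteq> {}"
  obtains p where "periodic_seq (card X) N p" "p ` {..<card X} = X"
proof -
  define K where "K = card X"
  have K: "0 < K" using assms by (simp add: K_def card_gt_0_iff)
  define Y where "Y = nat ` X"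
  have "inj_on nat X" 
    by (rule inj_onI) (metis assms(2) atLeastLessThan_iff eq_nat_nat_iff subsetD)
  then have cY: "card Y = K" and fY: "finite Y" by (simp_all add: Y_def K_def card_image assms(1))
  have "int (nat x) = x" if "x \<in> X" for x using assms(2) that by auto
  then have intY: "int ` Y = X" unfolding Y_def image_image by simp
  define e where "e i = int (enumerate Y i)" for i
  have "e ` {..<K} = int ` enumerate Y ` {..<K}" by (auto simp: e_def)
  then have eX: "e ` {..<K} = X" using enumerate_image[OF fY] intY cY by simp
  have e_mem: "e i \<in> {0..<N}" if "i < K" for i using that eX assms(2) by auto
  have e_less: "e i < e j" if "i < j" "j < K" for i j using that fY cY by (simp add: e_def)
  define p where "p i = e (i mod K) + N * int (i div K)" for i
  have "periodic_seq K N p"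
  proof
    show "strict_mono p"
    proof (rule strict_mono_Suc_iff[THEN iffD2], rule allI)
      fix i
      show "p i < p (Suc i)"
      proof (cases "Suc (i mod K) = K")
        case True
        then have "Suc i mod K = 0" "Suc i div K = Suc (i div K)"
          by (simp_all add: mod_Suc div_Suc)
        moreover have "e (i mod K) < e 0 + N" using e_mem[of "i mod K"] e_mem[of 0] K by auto
        ultimately show ?thesis unfolding p_def by (simp add: algebra_simps)
      next
        case False
        then have "Suc i mod K = Suc (i mod K)" "Suc i div K = i div K"
          by (simp_all add: mod_Suc div_Suc)
        moreover have "Suc (i mod K) < K" using False K by (simp add: Suc_lessI)
        ultimately show ?thesis using e_less[of "i mod K" "Suc (i mod K)"] unfolding p_def by simp
      qed
    qed
    show "p (i + K) = p i + N" for i using K by (simp add: p_def algebra_simps)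
    show "p ` {..<K} \<subseteq> {0..<N}" using e_mem by (auto simp: p_def)
  qed (rule K)
  moreover have "p ` {..<K} = X" using eX by (simp add: p_def)
  ultimately show ?thesis using that unfolding K_def by blast
qed

text \<open>\<open>G\<close> permutes the corners of a polygon with \<open>2 M\<close> sides around the vertices of the surface obtained
  by gluing the sides; \<open>G_glue\<close> says that the sides are glued in pairs.\<close>

locale corner_map =
  fixes M :: int and G :: "int \<Rightarrow> int"
  assumes M: "0 < M"
    and G_mod: "G (x mod (2 * M)) = G x"
    and G_range: "G x \<in> {0..<2 * M}"
    and G_parity: "even (G x) \<longleftrightarrow> even x"
    and G_glue: "G (G x - 1) = (x + 1) mod (2 * M)"
    and G_no_fix: "G x \<noteq> x mod (2 * M)"
begin

abbreviation "N \<equiv> 2 * M"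

text \<open>The corners at vertices of degree at least three: degree one is excluded by
  \<open>G_no_fix\<close>, and degree two means that \<open>G\<close> undoes itself.\<close>

definition special :: "int \<Rightarrow> bool" where
  "special x \<longleftrightarrow> G (G x) \<noteq> x mod N"

definition specials :: "int set" where
  "specials = {x \<in> {0..<N}. special x}"

lemma G_cong: "[x = y] (mod N) \<Longrightarrow> G x = G y"
  unfolding cong_def using G_mod by metis

lemma G_eqI: "[G x = y] (mod N) \<Longrightarrow> G x = y mod N"
  using G_range[of x] by (simp add: cong_def)

lemma G_inj: "G x = G y \<Longrightarrow> [x = y] (mod N)"
proof -
  assume "G x = G y"
  then have "[x + 1 = y + 1] (mod N)" using G_glue unfolding cong_def by metis
  then show ?thesis by (simp only: cong_add_rcancel)
qed

lemma special_cong: "[x = y] (mod N) \<Longrightarrow> special x \<longleftrightarrow> special y"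
  unfolding special_def using G_cong by (metis cong_def)

lemma special_mod: "special (x mod N) \<longleftrightarrow> special x"
  by (rule special_cong) (simp add: cong_def)

lemma special_G: "special (G x) \<longleftrightarrow> special x"
proof -
  have "G (G (G x)) = G x mod N \<longleftrightarrow> G (G (G x)) = G x" using G_range[of x] by simp
  also have "\<dots> \<longleftrightarrow> [G (G x) = x] (mod N)" using G_inj G_cong by blast
  also have "\<dots> \<longleftrightarrow> G (G x) = x mod N" using G_range[of "G x"] by (simp add: cong_def)
  finally show ?thesis by (simp add: special_def)
qed

text \<open>At a vertex of degree two \<open>G (x + 1)\<close> returns to \<open>x + 1\<close> under
  \<open>G\<close>, and by \<open>G_glue\<close> so does \<open>G x - 1\<close>; injectivity
  identifies the two. Thus the gluing of one side continues to the next in the opposite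
  direction.\<close>

lemma G_step:
  assumes "\<not> special (x + 1)"
  shows "[G (x + 1) = G x - 1] (mod N)"
proof -
  have "G (G (x + 1)) = G (G x - 1)" using assms G_glue by (simp add: special_def)
  then show ?thesis by (rule G_inj)
qed

end

text \<open>The face as a \<open>2 * H\<close>-gon with corners \<open>p i\<close>. The period of
  \<open>p\<close> is \<open>M\<close>, half the number of corners of \<open>G\<close>, which
  encodes the invariance under translation by \<open>M\<close>. The segment after \<open>p i\<close>
  is reflected onto the one opposite to it. Segments are half-open because the reflections on the
  two sides of a special corner disagree there.\<close>

locale pattern = corner_map M G + periodic_seq H M p for M G H p +
  assumes H: "H = 2 \<or> H = 3"
    and G_segment: "p i \<le> x \<Longrightarrow> x < p (Suc i) \<Longrightarrow> [G x = p i + p (Suc i) + M - x] (mod N)"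

section \<open>Classification of corner maps\<close>

text \<open>Side \<open>i\<close> of a hexagon is glued to side \<open>s i - 1\<close>. The
  hypotheses forbid vertices of degree one and two and sides glued to themselves; the conclusion
  says that opposite sides are glued.\<close>

lemma index_shift_6:
  fixes s :: "nat \<Rightarrow> nat"
  assumes "\<And>i. i < 6 \<Longrightarrow> s i < 6" "\<And>i. i < 6 \<Longrightarrow> s i \<noteq> i" "\<And>i. i < 6 \<Longrightarrow> s (s i) \<noteq> i"
    "\<And>i. i < 6 \<Longrightarrow> s i \<noteq> (i + 1) mod 6" "\<And>i. i < 6 \<Longrightarrow> s ((s i + 5) mod 6) = (i + 1) mod 6"
    and i: "i < 6"
  shows "s i = (i + 4) mod 6"
proof -
  have two: "s i \<noteq> (i + 2) mod 6" if "i < 6" for i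
  proof
    assume "s i = (i + 2) mod 6"
    moreover have "((i + 2) mod 6 + 5) mod 6 = (i + 1) mod 6"
      unfolding mod_add_left_eq using mod_add_self2[of "i + 1" 6] by (simp add: ac_simps)
    ultimately have "s ((i + 1) mod 6) = (i + 1) mod 6" using assms(5)[OF that] by simp
    then show False using assms(2)[of "(i + 1) mod 6"] by simp
  qed
  have vals: "s i = 0 \<or> s i = 1 \<or> s i = 2 \<or> s i = 3 \<or> s i = 4 \<or> s i = 5" if "i < 6" for i
    using assms(1)[OF that] by linarith
  have vals: "s i = 0 \<or> s i = 1 \<or> s i = 2 \<or> s i = 3 \<or> s i = 4 \<or> s i = 5" if "i < 6" for i
    using assms(1)[OF that] by linarith
  have c0: "s 0 = 3 \<or> s 0 = 4 \<or> s 0 = 5"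
    using vals[of 0] assms(2,4)[of 0] two[of 0] by auto
  have c1: "s 1 = 4 \<or> s 1 = 5 \<or> s 1 = 0"
    using vals[of 1] assms(2,4)[of 1] two[of 1] by auto
  have c2: "s 2 = 5 \<or> s 2 = 0 \<or> s 2 = 1"
    using vals[of 2] assms(2,4)[of 2] two[of 2] by auto
  have c3: "s 3 = 0 \<or> s 3 = 1 \<or> s 3 = 2"
    using vals[of 3] assms(2,4)[of 3] two[of 3] by auto
  have c4: "s 4 = 1 \<or> s 4 = 2 \<or> s 4 = 3"
    using vals[of 4] assms(2,4)[of 4] two[of 4] by auto
  have c5: "s 5 = 2 \<or> s 5 = 3 \<or> s 5 = 4"
    using vals[of 5] assms(2,4)[of 5] two[of 5] by auto
  have t0: "s 0 = 3 \<Longrightarrow> s 2 = 1 \<and> s 3 \<noteq> 0"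
    using assms(3)[of 0] assms(5)[of 0] by auto
  have t1: "s 1 = 4 \<Longrightarrow> s 3 = 2 \<and> s 4 \<noteq> 1"
    using assms(3)[of 1] assms(5)[of 1] by auto
  have t2: "s 2 = 5 \<Longrightarrow> s 4 = 3 \<and> s 5 \<noteq> 2"
    using assms(3)[of 2] assms(5)[of 2] by auto
  have t3: "s 3 = 0 \<Longrightarrow> s 5 = 4 \<and> s 0 \<noteq> 3"
    using assms(3)[of 3] assms(5)[of 3] by auto
  have t4: "s 4 = 1 \<Longrightarrow> s 0 = 5 \<and> s 1 \<noteq> 4"
    using assms(3)[of 4] assms(5)[of 4] by auto
  have t5: "s 5 = 2 \<Longrightarrow> s 1 = 0 \<and> s 2 \<noteq> 5"
    using assms(3)[of 5] assms(5)[of 5] by auto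
  have f0: "s 0 = 5 \<Longrightarrow> s 4 = 1"
    using assms(5)[of 0] by simp
  have f1: "s 1 = 0 \<Longrightarrow> s 5 = 2"
    using assms(5)[of 1] by simp
  have f2: "s 2 = 1 \<Longrightarrow> s 0 = 3"
    using assms(5)[of 2] by simp
  have f3: "s 3 = 2 \<Longrightarrow> s 1 = 4"
    using assms(5)[of 3] by simp
  have f4: "s 4 = 3 \<Longrightarrow> s 2 = 5"
    using assms(5)[of 4] by simp
  have f5: "s 5 = 4 \<Longrightarrow> s 3 = 0"
    using assms(5)[of 5] by simp
  have inj: "s i \<noteq> s j" if "i < 6" "j < 6" "i \<noteq> j" for i j
  proof
    assume "s i = s j"
    then have "(i + 1) mod 6 = (j + 1) mod 6" using assms(5)[OF that(1)] assms(5)[OF that(2)] by simp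
    then show False using that by (cases "i = 5"; cases "j = 5") auto
  qed
  \<comment> \<open>Since neighbouring sides are not glued (\<open>two\<close>), \<open>s i\<close>
    is \<open>i + 3\<close>, \<open>i + 4\<close> or \<open>i + 5\<close>. If it is
    \<open>i + 3\<close>, then gluing, injectivity and the absence of 2-cycles determine the values
    at \<open>i + 2\<close>, \<open>i + 3\<close> and \<open>i + 1\<close> in turn and leave none
    for \<open>i + 4\<close>. The following five claims are rotations of this one; by gluing,
    \<open>i + 5\<close> is then excluded as well.\<close>
  have n0: "s 0 \<noteq> 3"
  proof
    assume "s 0 = 3"
    then have "s 2 = 1" "s 3 \<noteq> 0" using t0 by simp_all
    then have "s 3 = 2" using c3 inj[of 2 3] by auto
    then have "s 4 \<noteq> 1" using f3 t1 by simp
    then show False using c4 inj[of 3 4] inj[of 0 4] \<open>s 0 = 3\<close> \<open>s 3 = 2\<close> by auto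
  qed
  have n1: "s 1 \<noteq> 4"
  proof
    assume "s 1 = 4"
    then have "s 3 = 2" "s 4 \<noteq> 1" using t1 by simp_all
    then have "s 4 = 3" using c4 inj[of 3 4] by auto
    then have "s 5 \<noteq> 2" using f4 t2 by simp
    then show False using c5 inj[of 4 5] inj[of 1 5] \<open>s 1 = 4\<close> \<open>s 4 = 3\<close> by auto
  qed
  have n2: "s 2 \<noteq> 5"
  proof
    assume "s 2 = 5"
    then have "s 4 = 3" "s 5 \<noteq> 2" using t2 by simp_all
    then have "s 5 = 4" using c5 inj[of 4 5] by auto
    then have "s 0 \<noteq> 3" using f5 t3 by simp
    then show False using c0 inj[of 5 0] inj[of 2 0] \<open>s 2 = 5\<close> \<open>s 5 = 4\<close> by auto
  qed
  have n3: "s 3 \<noteq> 0"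
  proof
    assume "s 3 = 0"
    then have "s 5 = 4" "s 0 \<noteq> 3" using t3 by simp_all
    then have "s 0 = 5" using c0 inj[of 5 0] by auto
    then have "s 1 \<noteq> 4" using f0 t4 by simp
    then show False using c1 inj[of 0 1] inj[of 3 1] \<open>s 3 = 0\<close> \<open>s 0 = 5\<close> by auto
  qed
  have n4: "s 4 \<noteq> 1"
  proof
    assume "s 4 = 1"
    then have "s 0 = 5" "s 1 \<noteq> 4" using t4 by simp_all
    then have "s 1 = 0" using c1 inj[of 0 1] by auto
    then have "s 2 \<noteq> 5" using f1 t5 by simp
    then show False using c2 inj[of 1 2] inj[of 4 2] \<open>s 4 = 1\<close> \<open>s 1 = 0\<close> by auto
  qed
  have n5: "s 5 \<noteq> 2"
  proof
    assume "s 5 = 2"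
    then have "s 1 = 0" "s 2 \<noteq> 5" using t5 by simp_all
    then have "s 2 = 1" using c2 inj[of 1 2] by auto
    then have "s 3 \<noteq> 0" using f2 t0 by simp
    then show False using c3 inj[of 2 3] inj[of 5 3] \<open>s 5 = 2\<close> \<open>s 2 = 1\<close> by auto
  qed
  have "s 0 = 4" "s 1 = 5" "s 2 = 0" "s 3 = 1" "s 4 = 2" "s 5 = 3"
    using c0 c1 c2 c3 c4 c5 f0 f1 f2 f3 f4 f5 n0 n1 n2 n3 n4 n5 by blast+
  moreover have "i = 0 \<or> i = 1 \<or> i = 2 \<or> i = 3 \<or> i = 4 \<or> i = 5" using i by linarith
  ultimately show ?thesis by auto
qed

text \<open>The square case: gluing two neighbouring sides would fix the corner between them, so
  only the opposite side remains.\<close>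

lemma index_shift_4:
  fixes s :: "nat \<Rightarrow> nat"
  assumes "\<And>i. i < 4 \<Longrightarrow> s i < 4" "\<And>i. i < 4 \<Longrightarrow> s i \<noteq> i"
    "\<And>i. i < 4 \<Longrightarrow> s i \<noteq> (i + 1) mod 4" "\<And>i. i < 4 \<Longrightarrow> s ((s i + 3) mod 4) = (i + 1) mod 4"
    and i: "i < 4"
  shows "s i = (i + 3) mod 4"
proof -
  have "s i \<noteq> (i + 2) mod 4"
  proof
    assume "s i = (i + 2) mod 4"
    moreover have "((i + 2) mod 4 + 3) mod 4 = (i + 1) mod 4"
      unfolding mod_add_left_eq using mod_add_self2[of "i + 1" 4] by (simp add: ac_simps)
    ultimately have "s ((i + 1) mod 4) = (i + 1) mod 4" using assms(4)[OF i] by simp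
    then show False using assms(2)[of "(i + 1) mod 4"] by simp
  qed
  moreover have "i = 0 \<or> i = 1 \<or> i = 2 \<or> i = 3" using i by linarith
  ultimately show ?thesis using assms(1,2,3)[OF i] by auto
qed

context corner_map
begin

lemma finite_specials: "finite specials"
  by (rule finite_subset[of _ "{0..<N}"]) (auto simp: specials_def)

lemma mod_specials: "x mod N \<in> specials \<longleftrightarrow> special x"
  using M special_mod by (simp add: specials_def)

text \<open>Away from the special corners \<open>G\<close> is a reflection, so it carries the segment that starts at
  the special corner \<open>p i\<close> backwards onto the one that ends at \<open>G (p i)\<close>. Comparing lengths, \<open>s\<close>
  satisfies the same gluing relation on indices as \<open>G\<close> does on corners.\<close>

lemma pattern_exists:
  assumes card: "card specials = 2 * H" and H: "H = 2 \<or> H = 3"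
  shows "\<exists>p. pattern M G H p"
proof -
  define K where "K = 2 * H"
  have K: "0 < K" using H by (auto simp: K_def)
  have "specials \<subseteq> {0..<N}" by (auto simp: specials_def)
  moreover have "specials \<noteq> {}" using card H by auto
  ultimately obtain p where p: "periodic_seq K N p" and pK: "p ` {..<K} = specials"
    using periodic_seq_exists[OF finite_specials] card unfolding K_def by metis
  interpret p: periodic_seq K N p by fact
  have special_range: "special x \<and> 0 \<le> x \<longleftrightarrow> x \<in> range p" for x
    using p.range_iff[of x] mod_specials[of x] pK by auto
  have special_p: "special (p i)" for i using special_range by blast
  define l where "l i = p (Suc i) - p i" for i
  have l_pos: "0 < l i" for i using p.less_iff[of i "Suc i"] by (simp add: l_def)
  have l_le: "l i \<le> N" for i using p.segment_length[of i] by (simp add: l_def)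
  have inside: "\<not> special (p i + j)" if "0 < j" "j < l i" for i j
    using p.segment_inside[of j i] that mod_specials pK by (auto simp: l_def)
  have "\<exists>t<K. p t = G (p i)" for i
  proof -
    have "G (p i) \<in> specials" using special_G special_p G_range[of "p i"] by (simp add: specials_def)
    then show ?thesis using pK by (metis imageE lessThan_iff)
  qed
  then obtain s where s: "\<And>i. s i < K" and p_s: "\<And>i. p (s i) = G (p i)" by metis
  have reflect_nat: "int j < l i \<Longrightarrow> [G (p i + int j) = p (s i) - int j] (mod N)" for i j
  proof (induction j)
    case (Suc j)
    have "[G (p i + int j + 1) = G (p i + int j) - 1] (mod N)"
      by (rule G_step) (use inside[of "int j + 1" i] Suc in \<open>simp add: add.assoc\<close>)
    moreover have "[G (p i + int j) - 1 = p (s i) - int j - 1] (mod N)"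
      using Suc by (intro cong_diff) auto
    ultimately have "[G (p i + int j + 1) = p (s i) - int j - 1] (mod N)" by (rule cong_trans)
    then show ?case by (simp add: algebra_simps)
  qed (simp add: p_s)
  have reflect: "[G (p i + j) = p (s i) - j] (mod N)" if "0 \<le> j" "j < l i" for i j
    using reflect_nat[of "nat j" i] that by simp
  \<comment> \<open>The segment of length \<open>l i\<close> after \<open>p i\<close> is reflected
    onto the corners before \<open>p (s i)\<close>. By \<open>G_glue\<close> its far end
    \<open>z\<close> is special, and a special corner strictly between would be the image of one
    inside the segment. So \<open>z\<close> is the special corner preceding \<open>p (s i)\<close>.
    Adding \<open>K\<close> avoids a truncated subtraction.\<close>
  have glue: "p (s i + K - 1) = p (s i + K) - l i" "G (p (s i + K - 1)) = p (Suc i) mod N" for i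
  proof -
    define u where "u = s i + K - 1"
    have Su: "Suc u = s i + K" using K by (simp add: u_def)
    define z where "z = p (Suc u) - l i"
    have pSu: "p (Suc u) = p (s i) + N" using Su p.shift by simp
    have Gl: "G (G (p i + (l i - 1)) - 1) = p (Suc i) mod N"
      using G_glue[of "p i + (l i - 1)"] by (simp add: l_def)
    have "[G (p i + (l i - 1)) - 1 = p (s i) - (l i - 1) - 1] (mod N)"
      using reflect[of "l i - 1" i] l_pos[of i] by (intro cong_diff) auto
    moreover have "[p (s i) - (l i - 1) - 1 = z] (mod N)"
      by (simp add: z_def pSu cong_iff_dvd_diff)
    ultimately have "[G (p i + (l i - 1)) - 1 = z] (mod N)" by (rule cong_trans)
    then have "G (G (p i + (l i - 1)) - 1) = G z" by (rule G_cong)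
    with Gl have Gz: "G z = p (Suc i) mod N" by simp
    then have "special z" using special_G[of z] special_mod special_p by metis
    moreover have "0 \<le> z" using l_le[of i] p.p_nonneg[of "s i"] pSu by (simp add: z_def)
    ultimately obtain v where v: "z = p v" using special_range by blast
    have "p v < p (Suc u)" using l_pos[of i] v by (simp add: z_def)
    then have "v \<le> u" using p.less_iff by simp
    moreover have "\<not> v < u"
    proof
      assume "v < u"
      define j where "j = p (Suc u) - p u"
      have j: "0 < j" "j < l i"
        using p.less_iff[of u "Suc u"] p.less_iff[of v u] \<open>v < u\<close> v by (auto simp: j_def z_def)
      have "[G (p i + j) = p (s i) - j] (mod N)" using reflect[of j i] j by simp
      moreover have "[p (s i) - j = p u] (mod N)" by (simp add: j_def pSu cong_iff_dvd_diff)
      ultimately have "[G (p i + j) = p u] (mod N)" by (rule cong_trans)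
      then have "special (p i + j)" using special_cong special_p special_G by metis
      then show False using inside j by blast
    qed
    ultimately have "v = u" by simp
    then show "p (s i + K - 1) = p (s i + K) - l i" "G (p (s i + K - 1)) = p (Suc i) mod N"
      using v Gz Su by (simp_all add: z_def u_def)
  qed
  have l_mod: "l (i mod K) = l i" for i
    using p.shift_mult[of "i mod K" "i div K"] p.shift_mult[of "Suc (i mod K)" "i div K"]
    by (simp add: l_def)
  have s_mod: "s (i mod K) = s i" for i
  proof -
    have "p (s (i mod K)) = p (s i)" unfolding p_s using p.p_mod[of i] G_mod by metis
    then show ?thesis by (simp add: p.eq_iff)
  qed
  have s_glue: "s ((s i + K - 1) mod K) = (i + 1) mod K" for i
  proof -
    have "p (s (s i + K - 1)) = p (Suc i mod K)" unfolding p_s glue(2) by (rule p.p_mod)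
    then show ?thesis by (simp add: p.eq_iff s_mod)
  qed
  have s_ne: "s i \<noteq> i" if "i < K" for i
  proof
    assume "s i = i"
    then have "G (p i) = p i mod N" using p_s[of i] p.p_mod[of i] that by simp
    then show False using G_no_fix by blast
  qed
  have ss_ne: "s (s i) \<noteq> i" if "i < K" for i
  proof
    assume "s (s i) = i"
    then have "G (G (p i)) = p i mod N" using p_s[of i] p_s[of "s i"] p.p_mod[of i] that by simp
    then show False using special_p[of i] by (simp add: special_def)
  qed
  \<comment> \<open>A side glued to itself has even length, because \<open>G\<close> preserves
    parity; the reflection would then fix its midpoint.\<close>
  have s_ne_Suc: "s i \<noteq> (i + 1) mod K" if "i < K" for i
  proof
    assume "s i = (i + 1) mod K"
    then have Gp: "G (p i) = p (Suc i) mod N" using p_s[of i] p.p_mod[of "Suc i"] by simp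
    then have "even (p (Suc i)) \<longleftrightarrow> even (p i)" using G_parity[of "p i"] by (simp add: dvd_mod_iff)
    then have "even (l i)" by (simp add: l_def)
    then obtain h where h: "l i = 2 * h" by blast
    have "[G (p i + h) = p (s i) - h] (mod N)" using reflect[of h i] l_pos[of i] h by simp
    moreover have "[p (s i) - h = p (Suc i) - h] (mod N)"
      by (intro cong_diff) (simp_all add: p_s Gp cong_def)
    ultimately have "[G (p i + h) = p (Suc i) - h] (mod N)" by (rule cong_trans)
    moreover have "p (Suc i) - h = p i + h" using h by (simp add: l_def)
    ultimately show False using G_eqI G_no_fix by metis
  qed
  have s_eq: "s i = (i + 1 + H) mod K" for i
  proof -
    have "s i = (i + 1 + H) mod K" if i: "i < K" for i
    proof (cases "H = 3")
      case True
      have six: "s ((s i + 5) mod 6) = (i + 1) mod 6" for i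
        using s_glue[of i] True by (simp add: K_def add.commute)
      have "s i = (i + 4) mod 6"
        by (rule index_shift_6) (use True six s s_ne ss_ne s_ne_Suc i in \<open>simp_all add: K_def\<close>)
      then show ?thesis using True by (simp add: K_def add.commute)
    next
      case False
      then have "H = 2" using H by simp
      have four: "s ((s i + 3) mod 4) = (i + 1) mod 4" for i
        using s_glue[of i] \<open>H = 2\<close> by (simp add: K_def add.commute)
      have "s i = (i + 3) mod 4"
        by (rule index_shift_4) (use \<open>H = 2\<close> four s s_ne s_ne_Suc i in \<open>simp_all add: K_def\<close>)
      then show ?thesis using \<open>H = 2\<close> by (simp add: K_def add.commute)
    qed
    from this[of "i mod K"] have "s i = (i mod K + (1 + H)) mod K" using s_mod[of i] K by simp
    then show ?thesis by (simp only: mod_add_left_eq add.assoc)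
  qed
  \<comment> \<open>The side glued to side \<open>i\<close> is the opposite one, of index
    \<open>i + H\<close> modulo \<open>K\<close>, and glued sides have equal length. Hence
    \<open>p (i + H) - p i\<close> is constant, and two such steps make up the period
    \<open>2 * M\<close>.\<close>
  have l_H: "l (i + H) = l i" for i
  proof -
    define u where "u = s i + K - 1"
    have Su: "Suc u = s i + K" using K by (simp add: u_def)
    have "Suc u mod K = Suc (i + H) mod K" using s_eq[of i] Su by simp
    then have "[u + 1 = i + H + 1] (mod K)" by (simp add: cong_def)
    then have "u mod K = (i + H) mod K" unfolding cong_add_rcancel_nat by (simp add: cong_def)
    then have "l u = l (i + H)" by (metis l_mod)
    moreover have "l u = l i" using glue(1)[of i] Su by (simp add: l_def u_def)
    ultimately show ?thesis by simp
  qed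
  have D: "p (i + H) - p i = p H - p 0" for i
  proof (induction i)
    case (Suc i)
    then show ?case using l_H[of i] by (simp add: l_def)
  qed simp
  have "H + H = 0 + K" by (simp add: K_def)
  then have "p (H + H) = p 0 + N" using p.shift[of 0] by simp
  then have "p H - p 0 = M" using D[of H] by simp
  then have shift: "p (i + H) = p i + M" for i using D[of i] by simp
  have "pattern M G H p"
  proof unfold_locales
    show "strict_mono p" by (rule p.mono)
    show "p (i + H) = p i + M" for i by (rule shift)
    show "p ` {..<H} \<subseteq> {0..<M}"
    proof
      fix x assume "x \<in> p ` {..<H}"
      then obtain i where i: "i < H" "x = p i" by blast
      then have "p (i + H) \<in> specials" using pK by (auto simp: K_def)
      then show "x \<in> {0..<M}" using shift[of i] i p.p_nonneg[of i] by (simp add: specials_def)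
    qed
    show "0 < H" using H by auto
    show "H = 2 \<or> H = 3" by (rule H)
    fix i x assume x: "p i \<le> x" "x < p (Suc i)"
    have "[G (p i + (x - p i)) = p (s i) - (x - p i)] (mod N)"
      using reflect[of "x - p i" i] x by (simp add: l_def)
    moreover have "[p (s i) - (x - p i) = p (Suc i + H) - (x - p i)] (mod N)"
      using p.p_mod[of "Suc i + H"] s_eq[of i] by (intro cong_diff) (auto simp: cong_def p.p_mod)
    ultimately have "[G (p i + (x - p i)) = p (Suc i + H) - (x - p i)] (mod N)" by (rule cong_trans)
    then show "[G x = p i + p (Suc i) + M - x] (mod N)"
      unfolding shift by (simp add: algebra_simps)
  qed
  then show ?thesis by blast
qed

end

section \<open>Special corners and uniqueness of a pattern\<close>

context pattern
begin

lemma shift_N: "p (i + 2 * H) = p i + N"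
proof -
  have *: "i + 2 * H = i + H + H" by simp
  show ?thesis unfolding * using shift[of i] shift[of "i + H"] by simp
qed

lemma G_p: "[G (p i) = p (Suc i + H)] (mod N)"
  using G_segment[of i "p i"] less_iff[of i "Suc i"] shift[of "Suc i"] by (simp add: algebra_simps)

lemma not_special_inside:
  assumes "p i < x" "x < p (Suc i)"
  shows "\<not> special x"
proof -
  define y where "y = p i + p (Suc i) + M - x"
  have "[G x = y] (mod N)" using G_segment[of i x] assms by (simp add: y_def)
  then have "G (G x) = G y" by (rule G_cong)
  moreover have "[G y = p (i + H) + p (Suc (i + H)) + M - y] (mod N)"
    by (rule G_segment) (use assms shift[of i] shift[of "Suc i"] in \<open>auto simp: y_def\<close>)
  moreover have "p (i + H) + p (Suc (i + H)) + M - y = x + N"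
    using shift[of i] shift[of "Suc i"] by (simp add: y_def)
  ultimately have "G (G x) = (x + N) mod N" using G_eqI by metis
  then show ?thesis by (simp add: special_def)
qed

text \<open>Applying \<open>G\<close> twice advances the index by two modulo \<open>2 * H\<close>,
  and \<open>2 * H\<close> is at least four.\<close>

lemma special_p: "special (p i)"
  unfolding special_def
proof
  assume "G (G (p i)) = p i mod N"
  then have "[G (G (p i)) = p i] (mod N)" using G_range[of "G (p i)"] by (simp add: cong_def)
  moreover have "G (G (p i)) = G (p (Suc i + H))" by (rule G_cong[OF G_p])
  then have "[G (G (p i)) = p (Suc (Suc i + H) + H)] (mod N)" using G_p by metis
  moreover have *: "Suc (Suc i + H) + H = Suc (Suc i) + 2 * H" by simp
  have "p (Suc (Suc i + H) + H) = p (Suc (Suc i)) + N" unfolding * by (rule shift_N)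
  ultimately have "[p (Suc (Suc i)) = p i] (mod N)" by (auto simp: cong_def)
  then have dvd: "N dvd p (Suc (Suc i)) - p i" by (simp add: cong_iff_dvd_diff)
  have pos: "p i < p (Suc (Suc i))" by (simp add: less_iff)
  have "p (Suc (Suc i)) < p (i + 2 * H)" using H by (intro iffD2[OF less_iff]) auto
  then have "p (Suc (Suc i)) - p i < N" using shift_N by simp
  then show False using dvd pos zdvd_not_zless[of "p (Suc (Suc i)) - p i" N] by simp
qed

lemma p_less_N_iff: "p i < N \<longleftrightarrow> i < 2 * H"
proof
  assume "p i < N"
  then have "p i < p (2 * H)" using shift_N[of 0] p0 by simp
  then show "i < 2 * H" by (simp add: less_iff)
next
  assume i: "i < 2 * H"
  show "p i < N"
  proof (cases "i < H")
    case True
    then have "p i \<in> {0..<M}" using range by blast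
    then show ?thesis using M by simp
  next
    case False
    then have "p (i - H) \<in> {0..<M}" using range i by (intro subsetD[OF range]) auto
    then show ?thesis using shift[of "i - H"] False by simp
  qed
qed

lemma specials_eq: "specials = p ` {..<2 * H}"
proof (intro equalityI subsetI)
  fix x assume x: "x \<in> specials"
  then have x': "0 \<le> x" "x < N" "special x" by (auto simp: specials_def)
  have "special (x + N)" using x'(3) special_cong[of "x + N" x] by (simp add: cong_def)
  moreover have "p 0 \<le> x + N" using p0 x' M by simp
  then obtain i where i: "p i \<le> x + N" "x + N < p (Suc i)" by (rule segment)
  ultimately have eq: "p i = x + N" using not_special_inside[of i "x + N"] by force
  then have "\<not> i < 2 * H" using p_less_N_iff[of i] x' by simp
  then have "p (i - 2 * H) = x" using shift_N[of "i - 2 * H"] eq by simp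
  then show "x \<in> p ` {..<2 * H}" using p_less_N_iff[of "i - 2 * H"] x' by auto
next
  fix x assume "x \<in> p ` {..<2 * H}"
  then show "x \<in> specials" using special_p p_nonneg p_less_N_iff by (auto simp: specials_def)
qed

text \<open>The other special corners are the translates of these by \<open>M\<close>, so this half
  is enough to recover the pattern.\<close>

lemma specials_Int: "specials \<inter> {0..<M} = p ` {..<H}"
proof -
  have "p i < M \<longleftrightarrow> i < H" for i
  proof
    assume "p i < M"
    then have "p i < p (0 + H)" using shift[of 0] p0 by simp
    then show "i < H" by (simp add: less_iff)
  qed (use range in auto)
  then show ?thesis unfolding specials_eq using p_nonneg by (auto simp: image_iff) 
qed

end

text \<open>The reflection at \<open>x\<close> depends only on the two special corners that enclose
  \<open>x\<close>.\<close>

lemma pattern_unique: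
  assumes "pattern M G H p" "pattern M G' H' q" "p ` {..<H} = q ` {..<H'}"
  shows "G = G'"
proof
  fix x
  interpret P: pattern M G H p by fact
  interpret Q: pattern M G' H' q by fact
  \<comment> \<open>Adding the period moves the representative beyond \<open>p 0\<close> and
    \<open>q 0\<close>, below which there are no segments.\<close>
  define y where "y = x mod (2 * M) + 2 * M"
  have xy: "[x = y] (mod (2 * M))" by (simp add: y_def cong_def)
  have "0 \<le> x mod (2 * M)" using P.M by simp
  then have "p 0 \<le> y" "q 0 \<le> y" unfolding y_def using P.p0 Q.p0 P.M by linarith+
  obtain i where i: "p i \<le> y" "y < p (Suc i)" using P.segment[OF \<open>p 0 \<le> y\<close>] .
  obtain j where j: "q j \<le> y" "y < q (Suc j)" using Q.segment[OF \<open>q 0 \<le> y\<close>] .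
  have "p i = q j" "p (Suc i) = q (Suc j)"
    using periodic_seq_unique[OF P.periodic_seq_axioms Q.periodic_seq_axioms assms(3) i j] by auto
  then have "G y = G' y"
    using P.G_eqI[OF P.G_segment[OF i]] Q.G_eqI[OF Q.G_segment[OF j]] by simp
  then show "G x = G' x" using P.G_cong[OF xy] Q.G_cong[OF xy] by simp
qed

section \<open>Construction of a pattern from its residues\<close>

lemma (in periodic_seq) segment_unique:
  assumes "p i \<le> x" "x < p (Suc i)" "p j \<le> x" "x < p (Suc j)"
  shows "i = j"
proof -
  have "p i < p (Suc j)" "p j < p (Suc i)" using assms by linarith+
  then show ?thesis by (simp add: less_iff)
qed

text \<open>Define \<open>G\<close> by the required reflections. They fit together modulo
  \<open>2 * M\<close>, and gluing holds because a segment and its translate by \<open>M\<close> are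
  reflected onto each other. The parity hypothesis says precisely that these reflections preserve
  parity.\<close>

lemma pattern_of_seq:
  assumes "periodic_seq H M p" and H: "H = 2 \<or> H = 3"
    and parity: "\<And>i. even (p i + p (Suc i) + M)"
  shows "\<exists>G. pattern M G H p"
proof -
  interpret periodic_seq H M p by fact
  define N where "N = 2 * M"
  have M: "0 < M" using p0 by linarith
  have N: "0 < N" using M by (simp add: N_def)
  have shift_N: "p (i + 2 * H * q) = p i + N * int q" for i q
    using shift_mult[of i "2 * q"] by (simp add: N_def mult.assoc mult.left_commute)
  \<comment> \<open>A representative in \<open>{N..<2 * N}\<close>, so that it lies in some
    segment.\<close>
  define r where "r x = x mod N + N" for x
  have r_cong: "[r x = x] (mod N)" for x by (simp add: r_def cong_def)
  have "\<exists>i. p i \<le> r x \<and> r x < p (Suc i)" for x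
  proof -
    have "0 \<le> x mod N" using N by simp
    then have "p 0 \<le> r x" using p0 M unfolding r_def N_def by linarith
    then show ?thesis using segment by metis
  qed
  then obtain idx where idx: "\<And>x. p (idx x) \<le> r x" "\<And>x. r x < p (Suc (idx x))" by metis
  define G where "G x = (p (idx x) + p (Suc (idx x)) + M - r x) mod N" for x
  have G_mod: "G (x mod N) = G x" for x
  proof -
    have "r (x mod N) = r x" by (simp add: r_def)
    then have "idx (x mod N) = idx x" using segment_unique idx by metis
    then show ?thesis using \<open>r (x mod N) = r x\<close> by (simp add: G_def)
  qed
  then have G_cong: "G x = G y" if "[x = y] (mod N)" for x y using that unfolding cong_def by metis
  have G_segment: "[G x = p i + p (Suc i) + M - x] (mod N)" if x: "p i \<le> x" "x < p (Suc i)" for i x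
  proof -
    define q where "q = nat (x div N)"
    have "0 \<le> x" using p_nonneg[of i] x by simp
    then have q: "x + N = r x + N * int q"
      using N by (simp add: r_def q_def pos_imp_zdiv_nonneg_iff)
    have "p (i + 2 * H * 1) \<le> x + N" "x + N < p (Suc i + 2 * H * 1)"
      unfolding shift_N using x by simp_all
    moreover have "p (idx x + 2 * H * q) \<le> x + N" "x + N < p (Suc (idx x) + 2 * H * q)"
      unfolding shift_N q using idx[of x] by simp_all
    ultimately have "i + 2 * H * 1 = idx x + 2 * H * q" by (intro segment_unique[of _ "x + N"]) auto
    then have "p i + N * int 1 = p (idx x) + N * int q" "p (Suc i) + N * int 1 = p (Suc (idx x)) + N * int q"
      by (metis shift_N, metis shift_N add_Suc)
    then have eq: "p i + p (Suc i) + M - x = p (idx x) + p (Suc (idx x)) + M - r x + N * (int q - 1)"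
      using q by (simp add: algebra_simps)
    show ?thesis unfolding eq G_def cong_def by simp
  qed
  have "pattern M G H p"
  proof (unfold_locales, fold N_def)
    show "0 < M" by (rule M)
    show "G (x mod N) = G x" for x by (rule G_mod)
    show "G x \<in> {0..<N}" for x using N by (simp add: G_def)
    show "even (G x) \<longleftrightarrow> even x" for x
    proof -
      have "even (G x) \<longleftrightarrow> even (p (idx x) + p (Suc (idx x)) + M - r x)"
        unfolding G_def N_def by (simp add: dvd_mod_iff)
      also have "\<dots> \<longleftrightarrow> even (r x)" using parity[of "idx x"] by (simp only: even_diff) simp
      also have "\<dots> \<longleftrightarrow> even x" unfolding r_def N_def by (simp add: dvd_mod_iff)
      finally show ?thesis .
    qed
    show "G (G x - 1) = (x + 1) mod N" for x
    proof -
      let ?i = "idx x"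
      \<comment> \<open>Reflection turns the half-open segment around; subtracting 1 makes it
        half-open at the right end again, so \<open>z\<close> lies in segment
        \<open>?i + H\<close>.\<close>
      define z where "z = p ?i + p (Suc ?i) + M - r x - 1"
      have "[G x = z + 1] (mod N)" by (simp add: G_def z_def cong_def)
      then have "[G x - 1 = z + 1 - 1] (mod N)" by (intro cong_diff) auto
      then have "G (G x - 1) = G z" by (intro G_cong) simp
      moreover have "[G z = p (?i + H) + p (Suc (?i + H)) + M - z] (mod N)"
        by (rule G_segment) (use idx[of x] shift[of ?i] shift[of "Suc ?i"] in \<open>auto simp: z_def\<close>)
      moreover have "p (?i + H) + p (Suc (?i + H)) + M - z = r x + 1 + N"
        using shift[of ?i] shift[of "Suc ?i"] by (simp add: z_def N_def)
      moreover have "[r x + 1 + N = x + 1] (mod N)"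
        using cong_add[OF r_cong cong_refl[of 1]] by (simp add: cong_def)
      ultimately have "[G (G x - 1) = x + 1] (mod N)" by (metis cong_trans)
      then show ?thesis using N by (simp add: cong_def G_def)
    qed
    show "G x \<noteq> x mod N" for x
    proof
      assume "G x = x mod N"
      then have "[p (idx x) + p (Suc (idx x)) + M - r x = r x] (mod N)"
        using r_cong[of x] by (simp add: G_def cong_def)
      then have "N dvd p (idx x) + p (Suc (idx x)) + M - r x - r x" by (simp add: cong_iff_dvd_diff)
      moreover have "p (Suc (idx x)) < p (idx x + H)" using H by (intro iffD2[OF less_iff]) auto
      then have "p (Suc (idx x)) < p (idx x) + M" using shift by simp
      then have "0 < p (idx x) + p (Suc (idx x)) + M - r x - r x" "p (idx x) + p (Suc (idx x)) + M - r x - r x < N"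
        using idx[of x] by (auto simp: N_def)
      ultimately show False using zdvd_not_zless by blast
    qed
    show "H = 2 \<or> H = 3" by (rule H)
    show "p i \<le> x \<Longrightarrow> x < p (Suc i) \<Longrightarrow> [G x = p i + p (Suc i) + M - x] (mod N)" for i x
      by (rule G_segment)
  qed
  then show ?thesis by blast
qed

section \<open>The corner map of a core\<close>

lemma orbit_two: "f (f x) = x \<Longrightarrow> orbit f x = {x, f x}"
proof (intro equalityI subsetI)
  fix y assume "f (f x) = x" "y \<in> orbit f x"
  from this(2) show "y \<in> {x, f x}" by induction (use \<open>f (f x) = x\<close> in auto)
next
  fix y assume *: "f (f x) = x" "y \<in> {x, f x}"
  have "f x \<in> orbit f x" by (rule orbit.base)
  with * show "y \<in> orbit f x" by (metis insertE orbit.step singletonD)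
qed

lemma orbit_three: "f (f (f x)) = x \<Longrightarrow> orbit f x = {x, f x, f (f x)}"
proof (intro equalityI subsetI)
  fix y assume "f (f (f x)) = x" "y \<in> orbit f x"
  from this(2) show "y \<in> {x, f x, f (f x)}" by induction (use \<open>f (f (f x)) = x\<close> in auto)
next
  fix y assume *: "f (f (f x)) = x" "y \<in> {x, f x, f (f x)}"
  have 1: "f x \<in> orbit f x" by (rule orbit.base)
  have 2: "f (f x) \<in> orbit f x" by (rule orbit.step[OF 1])
  have 3: "f (f (f x)) \<in> orbit f x" by (rule orbit.step[OF 2])
  show "y \<in> orbit f x" using * 1 2 3 by auto
qed

lemma orbit_four: "f (f (f (f x))) = x \<Longrightarrow> orbit f x = {x, f x, f (f x), f (f (f x))}"
proof (intro equalityI subsetI)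
  fix y assume "f (f (f (f x))) = x" "y \<in> orbit f x"
  from this(2) show "y \<in> {x, f x, f (f x), f (f (f x))}"
    by induction (use \<open>f (f (f (f x))) = x\<close> in auto)
next
  fix y assume *: "f (f (f (f x))) = x" "y \<in> {x, f x, f (f x), f (f (f x))}"
  have 1: "f x \<in> orbit f x" by (rule orbit.base)
  have 2: "f (f x) \<in> orbit f x" by (rule orbit.step[OF 1])
  have 3: "f (f (f x)) \<in> orbit f x" by (rule orbit.step[OF 2])
  have 4: "f (f (f (f x))) \<in> orbit f x" by (rule orbit.step[OF 3])
  show "y \<in> orbit f x" using * 1 2 3 4 by auto
qed

text \<open>The witness \<open>c\<close> is the number of orbits with at least three elements.\<close>

lemma derangement_orbit_count:
  assumes f: "f permutes A" "finite A" and nf: "\<And>x. x \<in> A \<Longrightarrow> f x \<noteq> x"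
  defines "X \<equiv> {x \<in> A. f (f x) \<noteq> x}"
  shows "\<exists>c. card A + 2 * c = 2 * card (orbit f ` A) + card X \<and> 3 * c \<le> card X \<and>
    (c = 0 \<longrightarrow> card X = 0) \<and> (\<forall>h. (\<forall>x\<in>X. card (orbit f x) = h) \<longrightarrow> card X = h * c)"
proof -
  define P where "P = orbit f ` A"
  define Q where "Q = orbit f ` X"
  have finP: "finite P" using f by (simp add: P_def)
  have XA: "X \<subseteq> A" by (auto simp: X_def)
  have QP: "Q \<subseteq> P" using XA by (auto simp: P_def Q_def)
  have self: "x \<in> orbit f x" for x using permutes_self_in_orbit[OF f] .
  have orbA: "orbit f x \<subseteq> A" if "x \<in> A" for x using permutes_orbit_subset[OF f(1) that] .
  have fin: "finite O'" if "O' \<in> P" for O'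
  proof -
    from that obtain x where "x \<in> A" "O' = orbit f x" by (auto simp: P_def)
    then show ?thesis using finite_subset[OF orbA f(2)] by simp
  qed
  have disj: "disjoint P"
  proof (rule disjointI)
    fix a b assume ab: "a \<in> P" "b \<in> P" "a \<noteq> b"
    then obtain x y where xy: "a = orbit f x" "b = orbit f y" by (auto simp: P_def)
    show "a \<inter> b = {}"
    proof (rule ccontr)
      assume "a \<inter> b \<noteq> {}"
      then obtain z where "z \<in> orbit f x" "z \<in> orbit f y" using xy by blast
      then have "orbit f x = orbit f y" using orbit_eq_if_in[OF f] by metis
      then show False using ab xy by simp
    qed
  qed
  have UP: "\<Union> P = A" using self orbA by (auto simp: P_def)
  have X_orbit: "y \<in> X" if "x \<in> X" "y \<in> orbit f x" for x y
  proof (rule ccontr)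
    assume "y \<notin> X"
    moreover have "y \<in> A" using that XA orbA by blast
    ultimately have "f (f y) = y" by (simp add: X_def)
    then have "orbit f y = {y, f y}" by (rule orbit_two)
    moreover have "orbit f y = orbit f x" using orbit_eq_if_in[OF f that(2)] .
    ultimately have "x \<in> {y, f y}" using self by blast
    then have "f (f x) = x" using \<open>f (f y) = y\<close> by auto
    then show False using that by (simp add: X_def)
  qed
  have UQ: "\<Union> Q = X" using self X_orbit by (auto simp: Q_def)
  have cardA: "card A = sum card P"
    unfolding UP[symmetric] by (rule card_Union_disjoint) (use disj fin in auto)
  have cardX: "card X = sum card Q"
    unfolding UQ[symmetric]
    by (rule card_Union_disjoint) (use disj fin QP pairwise_subset in auto)
  have two: "card O' = 2" if "O' \<in> P - Q" for O'
  proof -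
    from that obtain x where x: "x \<in> A" "O' = orbit f x" "x \<notin> X" by (auto simp: P_def Q_def)
    then have "O' = {x, f x}" using orbit_two[of f x] by (simp add: X_def)
    then show ?thesis using nf[OF x(1)] by simp
  qed
  have three: "3 \<le> card O'" if "O' \<in> Q" for O'
  proof -
    from that obtain x where x: "x \<in> X" "O' = orbit f x" by (auto simp: Q_def)
    have "f x \<in> orbit f x" by (rule orbit.base)
    moreover from this have "f (f x) \<in> orbit f x" by (rule orbit.step)
    ultimately have "{x, f x, f (f x)} \<subseteq> O'" using self x by auto
    moreover have "f (f x) \<noteq> f x" using nf[of x] x XA permutes_inj[OF f(1)] by (auto dest: injD)
    then have "card {x, f x, f (f x)} = 3" using nf[of x] x XA by (auto simp: X_def)
    ultimately show ?thesis using card_mono[of O'] fin QP that by (metis subsetD)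
  qed
  have "sum card P = sum card (P - Q) + sum card Q" using sum.subset_diff[OF QP finP] .
  also have "sum card (P - Q) = 2 * card (P - Q)" using two by simp
  also have "card (P - Q) = card P - card Q" using card_Diff_subset[OF finite_subset[OF QP finP] QP] .
  finally have "card A = 2 * (card P - card Q) + card X" using cardA cardX by simp
  moreover have "card Q \<le> card P" using card_mono[OF finP QP] .
  ultimately have 1: "card A + 2 * card Q = 2 * card (orbit f ` A) + card X" by (simp add: P_def)
  have 2: "3 * card Q \<le> card X" unfolding cardX using sum_bounded_below[of Q 3 card] three by simp
  have 3: "card X = 0" if "card Q = 0"
    using that finite_subset[OF QP finP] cardX by simp
  have 4: "card X = h * card Q" if "\<And>x. x \<in> X \<Longrightarrow> card (orbit f x) = h" for h
  proof -
    have "sum card Q = sum (\<lambda>_. h) Q" by (rule sum.cong) (use that in \<open>auto simp: Q_def\<close>)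
    then show ?thesis using cardX by simp
  qed
  show ?thesis using 1 2 3 4 by (intro exI[of _ "card Q"]) simp
qed

definition corner :: "nat \<Rightarrow> (nat \<Rightarrow> nat) \<Rightarrow> int \<Rightarrow> int" where
  "corner m b x = (let y = x mod (2 * int m) in
     if even y then 2 * int (dual m b (nat (y div 2))) else 2 * int (b (nat (y div 2))) + 1)"

lemma corner_even: "i < m \<Longrightarrow> corner m b (2 * int i) = 2 * int (dual m b i)"
  by (simp add: corner_def)

lemma corner_odd:
  assumes "i < m" shows "corner m b (2 * int i + 1) = 2 * int (b i) + 1"
proof -
  have "(2 * int i + 1) mod (2 * int m) = 2 * int i + 1" using assms by simp
  then show ?thesis by (simp add: corner_def)
qed

lemma corner_mod: "corner m b (x mod (2 * int m)) = corner m b x"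
  by (simp add: corner_def)

lemma corner_cases:
  fixes x :: int
  assumes "0 < m"
  obtains (even) i where "i < m" "x mod (2 * int m) = 2 * int i"
    | (odd) i where "i < m" "x mod (2 * int m) = 2 * int i + 1"
proof -
  define y where "y = x mod (2 * int m)"
  have y: "0 \<le> y" "y < 2 * int m" using assms by (simp_all add: y_def)
  have lt: "nat (y div 2) < m" using y by linarith
  have "y = 2 * int (nat (y div 2)) \<or> y = 2 * int (nat (y div 2)) + 1" using y by linarith
  then show ?thesis using that lt unfolding y_def by blast
qed

locale core_corner =
  fixes m :: nat and b :: "nat \<Rightarrow> nat"
  assumes m: "0 < m" and b: "b permutes {..<m}"
    and b_ne: "\<And>i. i < m \<Longrightarrow> b i \<noteq> i" and a_ne: "\<And>i. i < m \<Longrightarrow> dual m b i \<noteq> i"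
begin

abbreviation "a \<equiv> dual m b"

lemma a: "a permutes {..<m}" by (rule dual_permutes[OF b])

lemma a_lt: "i < m \<Longrightarrow> a i < m" and b_lt: "i < m \<Longrightarrow> b i < m"
  using permutes_in_image[OF a] permutes_in_image[OF b] by auto

lemma double_Suc_mod: "i < m \<Longrightarrow> 2 * int (Suc i mod m) = (2 * int i + 2) mod (2 * int m)"
proof (cases "Suc i = m")
  case True
  then have *: "2 * int i + 2 = 2 * int m" by simp
  show ?thesis unfolding * using True by simp
qed auto

lemma even_mod: "even (x mod (2 * int m)) \<longleftrightarrow> even x"
  by (simp add: dvd_mod_iff)

text \<open>Gluing is the relation \<open>a (b i) = i + 1\<close>: from the odd corner of
  \<open>i\<close> one reaches the odd corner of \<open>b i\<close>, the corner before it is the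
  even one of \<open>b i\<close>, and \<open>a\<close> leads to the even corner of
  \<open>i + 1\<close>. For an even corner the same relation is read backwards, with
  \<open>i = b j\<close>.\<close>

sublocale corner_map "int m" "corner m b"
proof
  show "0 < int m" using m by simp
  fix x
  show "corner m b (x mod (2 * int m)) = corner m b x" by (rule corner_mod)
  have "corner m b x \<in> {0..<2 * int m} \<and> (even (corner m b x) \<longleftrightarrow> even x) \<and>
      corner m b (corner m b x - 1) = (x + 1) mod (2 * int m) \<and> corner m b x \<noteq> x mod (2 * int m)"
  proof (cases x rule: corner_cases[OF m])
    case (1 i)
    then have Gx: "corner m b x = 2 * int (a i)" using corner_even[of i m b] corner_mod[of m b x] by simp
    obtain j where j: "j < m" "b j = i" using permutes_image[OF b] 1 by (metis imageE lessThan_iff)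
    have "a i = Suc j mod m" using dual_comp[OF b, of j] j by (simp add: cyc_def)
    then have "corner m b x - 1 = (2 * int j + 2) mod (2 * int m) - 1" using Gx double_Suc_mod[OF j(1)] by simp
    then have "(corner m b x - 1) mod (2 * int m) = (2 * int j + 2 - 1) mod (2 * int m)"
      by (simp only: mod_diff_left_eq)
    then have "corner m b (corner m b x - 1) = corner m b (2 * int j + 1)"
      using corner_mod[of m b "corner m b x - 1"] corner_mod[of m b "2 * int j + 2 - 1"] by (simp add: add.commute)
    then have glue: "corner m b (corner m b x - 1) = 2 * int i + 1" using corner_odd[OF j(1)] j by simp
    have "(x + 1) mod (2 * int m) = (x mod (2 * int m) + 1) mod (2 * int m)" by (simp add: mod_simps)
    then have "(x + 1) mod (2 * int m) = 2 * int i + 1" unfolding 1(2) using 1(1) by simp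
    moreover have "even x" using 1(2) even_mod[of x] by simp
    ultimately show ?thesis using Gx glue a_lt[OF 1(1)] a_ne[OF 1(1)] 1(2) by simp
  next
    case (2 i)
    then have Gx: "corner m b x = 2 * int (b i) + 1" using corner_odd[of i m b] corner_mod[of m b x] by simp
    have "corner m b (corner m b x - 1) = 2 * int (a (b i))" unfolding Gx using corner_even[OF b_lt[OF 2(1)]] by simp
    also have "a (b i) = Suc i mod m" using dual_comp[OF b, of i] 2 by (simp add: cyc_def)
    also have "2 * int (Suc i mod m) = (x mod (2 * int m) + 1) mod (2 * int m)"
      unfolding 2(2) using double_Suc_mod[OF 2(1)] by (simp add: add.commute)
    also have "\<dots> = (x + 1) mod (2 * int m)" by (simp add: mod_simps)
    finally have glue: "corner m b (corner m b x - 1) = (x + 1) mod (2 * int m)" .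
    have "odd x" using 2(2) even_mod[of x] by simp
    then show ?thesis using Gx glue b_lt[OF 2(1)] b_ne[OF 2(1)] 2(2) by simp
  qed
  then show "corner m b x \<in> {0..<2 * int m}" "even (corner m b x) \<longleftrightarrow> even x"
    "corner m b (corner m b x - 1) = (x + 1) mod (2 * int m)" "corner m b x \<noteq> x mod (2 * int m)"
    by blast+
qed

lemma special_even: "i < m \<Longrightarrow> special (2 * int i) \<longleftrightarrow> a (a i) \<noteq> i"
  by (simp add: special_def corner_even a_lt)

lemma special_odd:
  assumes "i < m" shows "special (2 * int i + 1) \<longleftrightarrow> b (b i) \<noteq> i"
proof -
  have "(2 * int i + 1) mod (2 * int m) = 2 * int i + 1" using assms by simp
  then show ?thesis using assms by (simp add: special_def corner_odd b_lt)
qed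

lemma even_specials: "{x \<in> specials. even x} = (\<lambda>i. 2 * int i) ` {i \<in> {..<m}. a (a i) \<noteq> i}"
proof (intro equalityI subsetI)
  fix x assume x: "x \<in> {x \<in> specials. even x}"
  then have xm: "x mod (2 * int m) = x" by (simp add: specials_def)
  show "x \<in> (\<lambda>i. 2 * int i) ` {i \<in> {..<m}. a (a i) \<noteq> i}"
  proof (cases x rule: corner_cases[OF m])
    case (1 i)
    then have "x = 2 * int i" using xm by simp
    then show ?thesis using x 1 special_even by (auto simp: specials_def)
  next
    case (2 i)
    then show ?thesis using x xm by simp
  qed
qed (use special_even in \<open>auto simp: specials_def\<close>)

lemma odd_specials: "{x \<in> specials. odd x} = (\<lambda>i. 2 * int i + 1) ` {i \<in> {..<m}. b (b i) \<noteq> i}"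
proof (intro equalityI subsetI)
  fix x assume x: "x \<in> {x \<in> specials. odd x}"
  then have xm: "x mod (2 * int m) = x" by (simp add: specials_def)
  show "x \<in> (\<lambda>i. 2 * int i + 1) ` {i \<in> {..<m}. b (b i) \<noteq> i}"
  proof (cases x rule: corner_cases[OF m])
    case (1 i)
    then show ?thesis using x xm by simp
  next
    case (2 i)
    then have "x = 2 * int i + 1" using xm by simp
    then show ?thesis using x 2 special_odd by (auto simp: specials_def)
  qed
qed (use special_odd in \<open>auto simp: specials_def\<close>)

lemma card_even_specials: "card {x \<in> specials. even x} = card {i \<in> {..<m}. a (a i) \<noteq> i}"
  unfolding even_specials by (intro card_image inj_onI) simp

lemma card_odd_specials: "card {x \<in> specials. odd x} = card {i \<in> {..<m}. b (b i) \<noteq> i}"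
  unfolding odd_specials by (intro card_image inj_onI) simp

lemma card_specials:
  "card specials = card {i \<in> {..<m}. a (a i) \<noteq> i} + card {i \<in> {..<m}. b (b i) \<noteq> i}"
proof -
  have "specials = {x \<in> specials. even x} \<union> {x \<in> specials. odd x}" by blast
  then have "card specials = card {x \<in> specials. even x} + card {x \<in> specials. odd x}"
    using card_Un_disjoint[of "{x \<in> specials. even x}" "{x \<in> specials. odd x}"] finite_specials by auto
  then show ?thesis by (simp add: card_even_specials card_odd_specials)
qed

text \<open>Euler's count. If \<open>c\<close> and \<open>d\<close> are the numbers of cycles of
  length at least three, genus one yields \<open>2 * (c + d + 1)\<close> special corners. Each such
  cycle has at least three of them, so \<open>c + d\<close> is at most two; it is not zero, as there
  would be no special corner. Hence \<open>H = c + d + 1\<close> is 2 or 3.\<close>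

lemma pattern_if_genus_one:
  assumes "card (orbit a ` {..<m}) + card (orbit b ` {..<m}) + 1 = m"
  shows "\<exists>H p. pattern (int m) (corner m b) H p"
proof -
  from derangement_orbit_count[OF a finite_lessThan a_ne[OF lessThan_iff[THEN iffD1]]]
  obtain c where "card {..<m} + 2 * c = 2 * card (orbit a ` {..<m}) + card {i \<in> {..<m}. a (a i) \<noteq> i} \<and>
      3 * c \<le> card {i \<in> {..<m}. a (a i) \<noteq> i} \<and> (c = 0 \<longrightarrow> card {i \<in> {..<m}. a (a i) \<noteq> i} = 0) \<and>
      (\<forall>h. (\<forall>i\<in>{i \<in> {..<m}. a (a i) \<noteq> i}. card (orbit a i) = h) \<longrightarrow> card {i \<in> {..<m}. a (a i) \<noteq> i} = h * c)"
    by (rule exE)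
  then have c: "m + 2 * c = 2 * card (orbit a ` {..<m}) + card {i \<in> {..<m}. a (a i) \<noteq> i}" "3 * c \<le> card {i \<in> {..<m}. a (a i) \<noteq> i}" "c = 0 \<longrightarrow> card {i \<in> {..<m}. a (a i) \<noteq> i} = 0"
    by simp_all
  from derangement_orbit_count[OF b finite_lessThan b_ne[OF lessThan_iff[THEN iffD1]]]
  obtain d where "card {..<m} + 2 * d = 2 * card (orbit b ` {..<m}) + card {i \<in> {..<m}. b (b i) \<noteq> i} \<and>
      3 * d \<le> card {i \<in> {..<m}. b (b i) \<noteq> i} \<and> (d = 0 \<longrightarrow> card {i \<in> {..<m}. b (b i) \<noteq> i} = 0) \<and>
      (\<forall>h. (\<forall>i\<in>{i \<in> {..<m}. b (b i) \<noteq> i}. card (orbit b i) = h) \<longrightarrow> card {i \<in> {..<m}. b (b i) \<noteq> i} = h * d)"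
    by (rule exE)
  then have d: "m + 2 * d = 2 * card (orbit b ` {..<m}) + card {i \<in> {..<m}. b (b i) \<noteq> i}" "3 * d \<le> card {i \<in> {..<m}. b (b i) \<noteq> i}" "d = 0 \<longrightarrow> card {i \<in> {..<m}. b (b i) \<noteq> i} = 0"
    by simp_all
  have eq: "card specials = 2 * (c + d + 1)" using c(1) d(1) assms card_specials by simp
  have "c + d \<le> 2" using c(2) d(2) card_specials unfolding eq by simp
  moreover have "c + d \<noteq> 0"
  proof
    assume "c + d = 0"
    then have "c = 0" "d = 0" by simp_all
    then have "card specials = 0" using c(3) d(3) card_specials by presburger
    then show False using eq by simp
  qed
  ultimately have "c + d + 1 = 2 \<or> c + d + 1 = 3" by linarith
  then show ?thesis using pattern_exists[OF eq] by blast
qed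

end

section \<open>Cycle lengths and parities of the special corners\<close>

lemma card_orbit_three:
  assumes "inj f" "f x \<noteq> x" "f (f (f x)) = x"
  shows "card (orbit f x) = 3"
proof -
  have "f (f x) \<noteq> f x" using injD[OF assms(1), of "f x" x] assms(2) by blast
  moreover have "f (f x) \<noteq> x" using assms(2,3) by metis
  ultimately show ?thesis unfolding orbit_three[of f, OF assms(3)] using assms(2) by auto
qed

lemma card_orbit_four:
  assumes "inj f" "f (f x) \<noteq> x" "f (f (f (f x))) = x"
  shows "card (orbit f x) = 4"
proof -
  have 1: "f x \<noteq> x" using assms(2) by metis
  have 2: "f (f x) \<noteq> f x" using injD[OF assms(1), of "f x" x] 1 by blast
  have 3: "f (f (f x)) \<noteq> f (f x)" using injD[OF assms(1), of "f (f x)" "f x"] 2 by blast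
  have 4: "f (f (f x)) \<noteq> f x" using injD[OF assms(1), of "f (f x)" x] assms(2) by blast
  have 5: "f (f (f x)) \<noteq> x" using assms(3) 1 by metis
  have "x \<noteq> f x" "x \<noteq> f (f x)" "x \<noteq> f (f (f x))" "f x \<noteq> f (f x)" "f x \<noteq> f (f (f x))" "f (f x) \<noteq> f (f (f x))"
    using 1 2 3 4 5 assms(2) by metis+
  then show ?thesis unfolding orbit_four[of f, OF assms(3)] by simp
qed

lemma (in pattern) p_mod_N: "p j mod N = p (j mod (2 * H))"
proof -
  have H0: "0 < 2 * H" using H by auto
  have "p j = p (j mod (2 * H)) + N * int (j div (2 * H))"
    using shift_mult[of "j mod (2 * H)" "2 * (j div (2 * H))"]
    by (simp add: mult.assoc[symmetric] mult.commute[of H 2])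
  moreover have "0 \<le> p (j mod (2 * H))" "p (j mod (2 * H)) < N"
    using p_nonneg p_less_N_iff H0 by auto
  ultimately show ?thesis by simp
qed

lemma (in pattern) G_p_eq: "G (p i) = p ((i + 1 + H) mod (2 * H))"
  using G_eqI[OF G_p[of i]] p_mod_N[of "Suc i + H"] by simp

lemma lt6_cases: "(t::nat) < 6 \<Longrightarrow> t = 0 \<or> t = 1 \<or> t = 2 \<or> t = 3 \<or> t = 4 \<or> t = 5"
  by linarith

lemma lt4_cases: "(t::nat) < 4 \<Longrightarrow> t = 0 \<or> t = 1 \<or> t = 2 \<or> t = 3"
  by linarith

text \<open>On the indices of special corners \<open>G\<close> adds \<open>1 + H\<close> modulo
  \<open>2 * H\<close>; the element 4 has order three modulo 6, and 3 has order four modulo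
  4.\<close>

lemma (in pattern) G_cycle:
  assumes "x \<in> specials"
  shows "H = 3 \<Longrightarrow> G (G (G x)) = x" "H = 2 \<Longrightarrow> G (G (G (G x))) = x"
proof -
  obtain t where t: "t < 2 * H" "x = p t" using assms unfolding specials_eq by blast
  show "G (G (G x)) = x" if "H = 3"
  proof -
    have "t < 6" using t that by simp
    from lt6_cases[OF this] show ?thesis unfolding t(2) G_p_eq that by auto
  qed
  show "G (G (G (G x))) = x" if "H = 2"
  proof -
    have "t < 4" using t that by simp
    from lt4_cases[OF this] show ?thesis unfolding t(2) G_p_eq that by auto
  qed
qed

lemma (in pattern) parity_step: "even (p (Suc i)) \<longleftrightarrow> (even (p i) \<longleftrightarrow> even M)"
proof -
  have "even (p i) \<longleftrightarrow> even (p (Suc i + H) mod N)" using G_parity[of "p i"] G_eqI[OF G_p[of i]] by simp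
  also have "\<dots> \<longleftrightarrow> even (p (Suc i) + M)" using shift[of "Suc i"] by (simp add: dvd_mod_iff)
  finally show ?thesis by auto
qed

text \<open>For odd \<open>M\<close> the parities alternate along \<open>p\<close>, whereas
  \<open>p H = p 0 + M\<close> differs in parity from \<open>p 0\<close>; so \<open>H\<close> is
  odd.\<close>

lemma (in pattern) parity_cases:
  obtains (all_even) "even M" "\<And>i. even (p i)"
  | (all_odd) "even M" "\<And>i. odd (p i)"
  | (mixed) "odd M" "H = 3" "\<And>i. even (p i) \<longleftrightarrow> (even i \<longleftrightarrow> even (p 0))"
proof (cases "even M")
  case True
  have "even (p i) \<longleftrightarrow> even (p 0)" for i by (induction i) (use True parity_step in auto)
  then show ?thesis using that(1,2) True by metis
next
  case False
  have *: "even (p i) \<longleftrightarrow> (even i \<longleftrightarrow> even (p 0))" for i by (induction i) (use False parity_step in auto)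
  have "even (p H) \<longleftrightarrow> even (p 0 + M)" using shift[of 0] by simp
  then have "H \<noteq> 2" using *[of H] False by auto
  then show ?thesis using that(3) False * H by blast
qed

text \<open>The even corners among the last two special ones are the back points, see \<open>back_iff\<close> below.\<close>

definition back_count :: "nat \<Rightarrow> (nat \<Rightarrow> int) \<Rightarrow> nat" where
  "back_count H p = card {t \<in> {2 * H - 2, 2 * H - 1}. even (p t)}"

lemma (in pattern) back_count:
  "even M \<Longrightarrow> even (p 0) \<Longrightarrow> back_count H p = 2"
  "even M \<Longrightarrow> odd (p 0) \<Longrightarrow> back_count H p = 0"
  "odd M \<Longrightarrow> back_count H p = 1"
proof -
  have ne: "2 * H - 2 \<noteq> 2 * H - 1" using H by auto
  show "back_count H p = 2" if "even M" "even (p 0)"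
  proof (cases rule: parity_cases)
    case all_even
    then have "{t \<in> {2 * H - 2, 2 * H - 1}. even (p t)} = {2 * H - 2, 2 * H - 1}" by auto
    then show ?thesis using ne by (simp add: back_count_def)
  qed (use that in auto)
  show "back_count H p = 0" if "even M" "odd (p 0)"
    by (cases rule: parity_cases) (use that in \<open>auto simp: back_count_def\<close>)
  show "back_count H p = 1" if "odd M"
  proof (cases rule: parity_cases)
    case mixed
    have "{t \<in> {4, 5}. even (p t)} = (if even (p 0) then {4} else {5})"
      using mixed(3)[of 4] mixed(3)[of 5] by auto
    then show ?thesis using mixed(2) by (simp add: back_count_def)
  qed (use that in auto)
qed

text \<open>The parity of \<open>p t\<close> depends only on that of \<open>t\<close>, so the last
  two of the \<open>2 * H\<close> special corners represent all of them, each standing for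
  \<open>H\<close> corners.\<close>

lemma (in pattern) card_specials_parity:
  "card {x \<in> specials. even x} = H * back_count H p"
  "card {x \<in> specials. odd x} + H * back_count H p = 2 * H"
proof -
  have inj: "inj p" by (rule injI) (simp add: eq_iff)
  have total: "card specials = 2 * H" unfolding specials_eq by (simp add: card_image inj_on_subset[OF inj])
  have "specials = {x \<in> specials. even x} \<union> {x \<in> specials. odd x}" by blast
  then have sum: "card specials = card {x \<in> specials. even x} + card {x \<in> specials. odd x}"
    using card_Un_disjoint[of "{x \<in> specials. even x}" "{x \<in> specials. odd x}"] finite_specials by auto
  show ev: "card {x \<in> specials. even x} = H * back_count H p"
  proof (cases rule: parity_cases)
    case all_even
    then have "{x \<in> specials. even x} = specials" by (auto simp: specials_eq)
    then show ?thesis using total back_count(1) all_even by simp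
  next
    case all_odd
    then have "{x \<in> specials. even x} = {}" by (auto simp: specials_eq)
    then show ?thesis using back_count(2) all_odd by (simp del: Collect_empty_eq)
  next
    case mixed
    have "{x \<in> specials. even x} = p ` {t \<in> {..<6}. even (p t)}"
      unfolding specials_eq mixed(2) by auto
    also have "{t \<in> {..<6}. even (p t)} = {t \<in> {..<6}. even t \<longleftrightarrow> even (p 0)}"
      using mixed(3) by blast
    also have "{t \<in> {..<6}. even t \<longleftrightarrow> even (p 0)} = (if even (p 0) then {0, 2, 4} else {1, 3, 5::nat})"
      by (auto dest!: lt6_cases)
    finally have "card {x \<in> specials. even x} = card (if even (p 0) then {0, 2, 4} else {1, 3, 5::nat})"
      by (simp only: card_image inj_on_subset[OF inj subset_UNIV])
    also have "\<dots> = 3" by simp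
    finally show ?thesis using mixed back_count(3) by simp
  qed
  show "card {x \<in> specials. odd x} + H * back_count H p = 2 * H" using sum total ev by simp
qed

section \<open>Cycles and back points of a core with a given pattern\<close>

locale core_pattern = core_corner m b + pattern "int m" "corner m b" H p for m b H p
begin

lemma three:
  assumes "H = 3" "i < m"
  shows "a (a i) \<noteq> i \<Longrightarrow> a (a (a i)) = i" "b (b i) \<noteq> i \<Longrightarrow> b (b (b i)) = i"
proof -
  assume "a (a i) \<noteq> i"
  then have "2 * int i \<in> specials" using special_even[OF assms(2)] assms(2) by (simp add: specials_def)
  from G_cycle(1)[OF this assms(1)] show "a (a (a i)) = i" using assms(2) by (simp add: corner_even a_lt)
next
  assume "b (b i) \<noteq> i"
  then have "2 * int i + 1 \<in> specials" using special_odd[OF assms(2)] assms(2) by (simp add: specials_def)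
  from G_cycle(1)[OF this assms(1)] show "b (b (b i)) = i" using assms(2) by (simp add: corner_odd b_lt)
qed

lemma four:
  assumes "H = 2" "i < m"
  shows "a (a i) \<noteq> i \<Longrightarrow> a (a (a (a i))) = i" "b (b i) \<noteq> i \<Longrightarrow> b (b (b (b i))) = i"
proof -
  assume "a (a i) \<noteq> i"
  then have "2 * int i \<in> specials" using special_even[OF assms(2)] assms(2) by (simp add: specials_def)
  from G_cycle(2)[OF this assms(1)] show "a (a (a (a i))) = i" using assms(2) by (simp add: corner_even a_lt)
next
  assume "b (b i) \<noteq> i"
  then have "2 * int i + 1 \<in> specials" using special_odd[OF assms(2)] assms(2) by (simp add: specials_def)
  from G_cycle(2)[OF this assms(1)] show "b (b (b (b i))) = i" using assms(2) by (simp add: corner_odd b_lt)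
qed

text \<open>The degree of a vertex with special corners: three for the hexagon, four for the
  square.\<close>

definition "h = (if H = 3 then 3 else 4 :: nat)"

lemma card_orbit_a: "i \<in> {i \<in> {..<m}. a (a i) \<noteq> i} \<Longrightarrow> card (orbit a i) = h"
  using card_orbit_three[OF permutes_inj[OF a], of i] card_orbit_four[OF permutes_inj[OF a], of i]
    three(1)[of i] four(1)[of i] a_ne H by (auto simp: h_def)

lemma card_orbit_b: "i \<in> {i \<in> {..<m}. b (b i) \<noteq> i} \<Longrightarrow> card (orbit b i) = h"
  using card_orbit_three[OF permutes_inj[OF b], of i] card_orbit_four[OF permutes_inj[OF b], of i]
    three(2)[of i] four(2)[of i] b_ne H by (auto simp: h_def)

text \<open>If \<open>c\<close> cycles of \<open>a\<close> are longer than two, the special even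
  corners number \<open>h * c = H * back_count H p\<close>. For both values of \<open>H\<close> this
  makes \<open>(h - 2) * c\<close> equal to \<open>back_count H p\<close>, and this is the excess of
  \<open>m\<close> over \<open>2\<close> times the number of cycles.\<close>

lemma orbits_a: "m = 2 * card (orbit a ` {..<m}) + back_count H p"
proof -
  have X: "card {i \<in> {..<m}. a (a i) \<noteq> i} = H * back_count H p"
    using card_specials_parity(1) card_even_specials by simp
  from derangement_orbit_count[OF a finite_lessThan a_ne[OF lessThan_iff[THEN iffD1]]]
  obtain c where "card {..<m} + 2 * c = 2 * card (orbit a ` {..<m}) + card {i \<in> {..<m}. a (a i) \<noteq> i} \<and>
      3 * c \<le> card {i \<in> {..<m}. a (a i) \<noteq> i} \<and> (c = 0 \<longrightarrow> card {i \<in> {..<m}. a (a i) \<noteq> i} = 0) \<and>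
      (\<forall>h. (\<forall>i\<in>{i \<in> {..<m}. a (a i) \<noteq> i}. card (orbit a i) = h) \<longrightarrow> card {i \<in> {..<m}. a (a i) \<noteq> i} = h * c)"
    by (rule exE)
  then have "m + 2 * c = 2 * card (orbit a ` {..<m}) + H * back_count H p" "H * back_count H p = h * c"
    using card_orbit_a unfolding X by (simp, blast)
  then show ?thesis using H by (auto simp: h_def)
qed

lemma orbits_b: "m + back_count H p = 2 * card (orbit b ` {..<m}) + 2"
proof -
  have X: "card {i \<in> {..<m}. b (b i) \<noteq> i} + H * back_count H p = 2 * H"
    using card_specials_parity(2) card_odd_specials by simp
  from derangement_orbit_count[OF b finite_lessThan b_ne[OF lessThan_iff[THEN iffD1]]]
  obtain c where "card {..<m} + 2 * c = 2 * card (orbit b ` {..<m}) + card {i \<in> {..<m}. b (b i) \<noteq> i} \<and>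
      3 * c \<le> card {i \<in> {..<m}. b (b i) \<noteq> i} \<and> (c = 0 \<longrightarrow> card {i \<in> {..<m}. b (b i) \<noteq> i} = 0) \<and>
      (\<forall>h. (\<forall>i\<in>{i \<in> {..<m}. b (b i) \<noteq> i}. card (orbit b i) = h) \<longrightarrow> card {i \<in> {..<m}. b (b i) \<noteq> i} = h * c)"
    by (rule exE)
  then have "m + 2 * c = 2 * card (orbit b ` {..<m}) + card {i \<in> {..<m}. b (b i) \<noteq> i}"
    "card {i \<in> {..<m}. b (b i) \<noteq> i} = h * c"
    using card_orbit_b by (simp, blast)
  then have "m + 2 * c = 2 * card (orbit b ` {..<m}) + h * c" "h * c + H * back_count H p = 2 * H"
    using X by simp_all
  then show ?thesis using H by (auto simp: h_def)
qed

lemma genus_one: "card (orbit a ` {..<m}) + card (orbit b ` {..<m}) + 1 = m"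
  using orbits_a orbits_b by linarith

text \<open>The larger point of a transposition goes to the minimum, so it is no back point. On the
  indices of even special corners \<open>a\<close> acts by the cycles (0 4 2) and (1 5 3) of a
  hexagon or by (0 3 2 1) of a square. As \<open>p\<close> is increasing, the descents that do not
  end in the minimum start at 4 and 5, respectively at 2 and 3.\<close>

lemma back_iff:
  assumes i: "i < m"
  shows "i \<in> core_back_points m a \<longleftrightarrow> 2 * int i \<in> p ` {2 * H - 2, 2 * H - 1}"
proof (cases "a (a i) = i")
  case True
  have "i \<notin> core_back_points m a"
    using orbit_two[of a i, OF True] eq_Min_orbit_iff[OF a, of i] i by (auto simp: core_back_points_def)
  moreover have "2 * int i \<notin> specials" using special_even[OF i] True by (simp add: specials_def)
  then have "2 * int i \<notin> p ` {2 * H - 2, 2 * H - 1}" unfolding specials_eq using H by auto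
  ultimately show ?thesis by simp
next
  case False
  then have "2 * int i \<in> specials" using special_even[OF i] i by (simp add: specials_def)
  then obtain t where t: "t < 2 * H" "2 * int i = p t" unfolding specials_eq by blast
  have ai: "2 * int (a i) = p ((t + 1 + H) mod (2 * H))"
    using corner_even[OF i, of b] t(2) G_p_eq[of t] by simp
  have aai: "2 * int (a (a i)) = p (((t + 1 + H) mod (2 * H) + 1 + H) mod (2 * H))"
    using corner_even[OF a_lt[OF i], of b] ai G_p_eq[of "(t + 1 + H) mod (2 * H)"] by simp
  have cmp: "x < y \<longleftrightarrow> u < v" if "2 * int x = p u" "2 * int y = p v" for x y u v
    using that less_iff[of u v] by linarith
  have rhs: "2 * int i \<in> p ` {2 * H - 2, 2 * H - 1} \<longleftrightarrow> t \<in> {2 * H - 2, 2 * H - 1}"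
    unfolding t(2) by (auto simp: eq_iff)
  have bk: "i \<in> core_back_points m a \<longleftrightarrow> a i < i \<and> (\<exists>y\<in>orbit a i. y < a i)"
    using eq_Min_orbit_iff[OF a, of i] i by (auto simp: core_back_points_def)
  show ?thesis
  proof (cases "H = 3")
    case True
    then have t6: "t < 6" using t by simp
    have "orbit a i = {i, a i, a (a i)}" by (rule orbit_three) (rule three(1)[OF True i False])
    then have "i \<in> core_back_points m a \<longleftrightarrow> a i < i \<and> (i < a i \<or> a (a i) < a i)" unfolding bk by auto
    also have "\<dots> \<longleftrightarrow> (t + 4) mod 6 < t \<and> (t < (t + 4) mod 6 \<or> ((t + 4) mod 6 + 4) mod 6 < (t + 4) mod 6)"
      using cmp[OF ai t(2)] cmp[OF t(2) ai] cmp[OF aai ai] True by (simp add: add.commute)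
    also have "\<dots> \<longleftrightarrow> t \<in> {4, 5}" using lt6_cases[OF t6] by auto
    finally show ?thesis unfolding rhs using True by simp
  next
    case H3: False
    then have H2: "H = 2" using H by simp
    then have t4: "t < 4" using t by simp
    have aaai: "2 * int (a (a (a i))) = p ((((t + 1 + H) mod (2 * H) + 1 + H) mod (2 * H) + 1 + H) mod (2 * H))"
      using corner_even[OF a_lt[OF a_lt[OF i]], of b] aai
        G_p_eq[of "((t + 1 + H) mod (2 * H) + 1 + H) mod (2 * H)"] by simp
    have "orbit a i = {i, a i, a (a i), a (a (a i))}" by (rule orbit_four) (rule four(1)[OF H2 i False])
    then have "i \<in> core_back_points m a \<longleftrightarrow> a i < i \<and> (i < a i \<or> a (a i) < a i \<or> a (a (a i)) < a i)" unfolding bk by auto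
    also have "\<dots> \<longleftrightarrow> (t + 3) mod 4 < t \<and> (t < (t + 3) mod 4 \<or> ((t + 3) mod 4 + 3) mod 4 < (t + 3) mod 4 \<or>
        (((t + 3) mod 4 + 3) mod 4 + 3) mod 4 < (t + 3) mod 4)"
      using cmp[OF ai t(2)] cmp[OF t(2) ai] cmp[OF aai ai] cmp[OF aaai ai] H2 by (simp add: add.commute)
    also have "\<dots> \<longleftrightarrow> t \<in> {2, 3}" using lt4_cases[OF t4] by auto
    finally show ?thesis unfolding rhs using H2 by simp
  qed
qed

lemma card_core_back_points: "card (core_back_points m a) = back_count H p"
proof -
  have "(\<lambda>i. 2 * int i) ` core_back_points m a = p ` {t \<in> {2 * H - 2, 2 * H - 1}. even (p t)}"
  proof (intro equalityI subsetI)
    fix x assume "x \<in> (\<lambda>i. 2 * int i) ` core_back_points m a"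
    then obtain i where i: "i \<in> core_back_points m a" "x = 2 * int i" by blast
    then have "i < m" by (simp add: core_back_points_def)
    then obtain t where t: "t \<in> {2 * H - 2, 2 * H - 1}" "x = p t" using back_iff i by blast
    then have "p t = 2 * int i" using i(2) by simp
    then have "even (p t)" by (rule ssubst) simp
    then show "x \<in> p ` {t \<in> {2 * H - 2, 2 * H - 1}. even (p t)}" using t by blast
  next
    fix x assume "x \<in> p ` {t \<in> {2 * H - 2, 2 * H - 1}. even (p t)}"
    then obtain t where t: "t \<in> {2 * H - 2, 2 * H - 1}" "even (p t)" "x = p t" by blast
    then obtain y where y: "x = 2 * y" by auto
    have "t < 2 * H" using t(1) H by auto
    then have "0 \<le> x" "x < 2 * int m" using p_less_N_iff[of t] p_nonneg[of t] t(3) by auto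
    then have "nat y < m" "x = 2 * int (nat y)" using y by auto
    then show "x \<in> (\<lambda>i. 2 * int i) ` core_back_points m a" using back_iff[of "nat y"] t by blast
  qed
  then have "card ((\<lambda>i. 2 * int i) ` core_back_points m a) = card (p ` {t \<in> {2 * H - 2, 2 * H - 1}. even (p t)})"
    by simp
  moreover have "inj (\<lambda>i. 2 * int i)" "inj p" by (auto simp: inj_def eq_iff)
  ultimately show ?thesis by (simp only: card_image inj_on_subset[OF _ subset_UNIV] back_count_def)
qed

end

text \<open>The odd corners define \<open>b\<close>. By \<open>G_glue\<close> they determine the
  even corners, which therefore carry \<open>dual m b\<close>.\<close>

lemma core_of_corner_map:
  assumes "corner_map (int m) G"
  shows "\<exists>b. core_corner m b \<and> corner m b = G"
proof -
  interpret corner_map "int m" G by fact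
  have m: "0 < m" using M by simp
  define b where "b i = (if i < m then nat (G (2 * int i + 1) div 2) else i)" for i
  have G_odd: "G (2 * int i + 1) = 2 * int (b i) + 1" "b i < m" if "i < m" for i
  proof -
    have "odd (G (2 * int i + 1))" using G_parity by simp
    then obtain y where y: "G (2 * int i + 1) = 2 * y + 1" by (rule oddE)
    moreover have "0 \<le> G (2 * int i + 1)" "G (2 * int i + 1) < 2 * int m"
      using G_range[of "2 * int i + 1"] by auto
    ultimately have "0 \<le> y" "y < int m" by linarith+
    then show "G (2 * int i + 1) = 2 * int (b i) + 1" "b i < m" using y that by (simp_all add: b_def)
  qed
  have "inj_on b {..<m}"
  proof (rule inj_onI)
    fix i j assume ij: "i \<in> {..<m}" "j \<in> {..<m}" "b i = b j"
    then have "G (2 * int i + 1) = G (2 * int j + 1)" using G_odd by simp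
    then have "[2 * int i + 1 = 2 * int j + 1] (mod N)" by (rule G_inj)
    then have "2 * int i + 1 = 2 * int j + 1" by (rule cong_less_imp_eq_int[rotated 4]) (use ij in auto)
    then show "i = j" by simp
  qed
  moreover have "b ` {..<m} \<subseteq> {..<m}" using G_odd(2) by auto
  ultimately have "bij_betw b {..<m} {..<m}" by (simp add: bij_betw_def endo_inj_surj)
  then have b: "b permutes {..<m}" by (rule bij_imp_permutes) (simp add: b_def)
  have G_even: "G (2 * int i) = 2 * int (dual m b i)" if "i < m" for i
  proof -
    obtain j where j: "j < m" "b j = i"
      using permutes_image[OF b] \<open>i < m\<close> by (metis imageE lessThan_iff)
    have "G (2 * int i) = (2 * int j + 2) mod (2 * int m)"
      using G_glue[of "2 * int j + 1"] G_odd(1)[OF j(1)] j(2) by (simp add: add.commute)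
    also have "\<dots> = 2 * int (Suc j mod m)"
    proof (cases "Suc j = m")
      case True
      then have *: "2 * int j + 2 = 2 * int m" by simp
      show ?thesis unfolding * using True by simp
    qed (use j in auto)
    also have "Suc j mod m = dual m b i" using dual_comp[OF b, of j] j by (simp add: cyc_def)
    finally show ?thesis .
  qed
  have "b i \<noteq> i" if "i < m" for i
  proof
    assume "b i = i"
    then have "G (2 * int i + 1) = (2 * int i + 1) mod N" using G_odd(1)[OF that] that by simp
    then show False using G_no_fix by blast
  qed
  moreover have "dual m b i \<noteq> i" if "i < m" for i
  proof
    assume "dual m b i = i"
    then have "G (2 * int i) = (2 * int i) mod N" using G_even[OF that] that by simp
    then show False using G_no_fix by blast
  qed
  ultimately have "core_corner m b" using m b by unfold_locales
  moreover have "corner m b = G"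
  proof
    fix x
    show "corner m b x = G x"
    proof (cases x rule: corner_cases[OF m])
      case (1 i)
      then show ?thesis using corner_even[OF 1(1), of b] G_even[OF 1(1)] corner_mod[of m b x] G_mod[of x] by simp
    next
      case (2 i)
      then show ?thesis using corner_odd[OF 2(1), of b] G_odd(1)[OF 2(1)] corner_mod[of m b x] G_mod[of x] by simp
    qed
  qed
  ultimately show ?thesis by blast
qed

lemma corner_inj:
  assumes "core_corner m b" "core_corner m b'" "corner m b = corner m b'"
  shows "b = b'"
proof
  interpret x: core_corner m b by fact
  interpret y: core_corner m b' by fact
  fix i
  show "b i = b' i"
  proof (cases "i < m")
    case True
    have "2 * int (b i) + 1 = 2 * int (b' i) + 1"
      using corner_odd[OF True, of b] corner_odd[OF True, of b'] assms(3) by simp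
    then show ?thesis by simp
  next
    case False
    then show ?thesis using permutes_not_in[OF x.b] permutes_not_in[OF y.b] by simp
  qed
qed

section \<open>Counting cores\<close>

text \<open>The image of \<open>special_set\<close> on cores, described by residues alone; the
  equation with \<open>back_count\<close> prescribes the number of cycles of \<alpha>.\<close>

definition slots :: "nat \<Rightarrow> nat \<Rightarrow> int set set" where
  "slots m k = {Q. \<exists>H p. periodic_seq H (int m) p \<and> (H = 2 \<or> H = 3) \<and>
     (\<forall>i. even (p i + p (Suc i) + int m)) \<and> m = 2 * k + back_count H p \<and> Q = p ` {..<H}}"

lemma slotsI:
  "periodic_seq H (int m) p \<Longrightarrow> H = 2 \<or> H = 3 \<Longrightarrow> (\<And>i. even (p i + p (Suc i) + int m)) \<Longrightarrow>
    m = 2 * k + back_count H p \<Longrightarrow> p ` {..<H} \<in> slots m k"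
  unfolding slots_def by blast

definition special_set :: "nat \<Rightarrow> (nat \<Rightarrow> nat) \<Rightarrow> int set" where
  "special_set m b = corner_map.specials (int m) (corner m b) \<inter> {0..<int m}"

lemma core_pattern_exists:
  assumes "b \<in> core m k"
  shows "\<exists>H p. core_pattern m b H p"
proof -
  have "core_corner m b" using assms by unfold_locales (auto simp: core_def)
  moreover from core_corner.pattern_if_genus_one[OF this]
  obtain H p where "pattern (int m) (corner m b) H p" using assms by (auto simp: core_def)
  ultimately show ?thesis unfolding core_pattern_def by blast
qed

lemma core_pattern_mem:
  assumes "core_pattern m b H p"
  shows "b \<in> core m k \<longleftrightarrow> m = 2 * k + back_count H p"
proof -
  interpret core_pattern m b H p by fact
  show ?thesis using orbits_a genus_one b a_ne b_ne unfolding core_def by auto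
qed

lemma special_set_eq:
  assumes "core_pattern m b H p"
  shows "special_set m b = p ` {..<H}"
proof -
  interpret core_pattern m b H p by fact
  show ?thesis unfolding special_set_def by (rule specials_Int)
qed

lemma card_core_back_points:
  assumes "b \<in> core m k"
  shows "m = 2 * k + card (core_back_points m (dual m b))" "card (core_back_points m (dual m b)) \<le> 2"
proof -
  obtain H p where "core_pattern m b H p" using core_pattern_exists[OF assms] by blast
  then interpret core_pattern m b H p .
  show "m = 2 * k + card (core_back_points m (dual m b))"
    using core_pattern_mem[OF core_pattern_axioms] assms card_core_back_points by simp
  have "back_count H p \<le> 2" using back_count by (metis order.refl one_le_numeral zero_le)
  then show "card (core_back_points m (dual m b)) \<le> 2" using card_core_back_points by simp
qed

text \<open>Injective because a pattern determines its corner map and this determines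
  \<open>b\<close>. Surjective because \<open>pattern_of_seq\<close> realises every admissible set,
  and genus one then holds automatically.\<close>

lemma bij_betw_special_set: "bij_betw (special_set m) (core m k) (slots m k)"
proof (rule bij_betw_imageI)
  show "inj_on (special_set m) (core m k)"
  proof (rule inj_onI)
    fix b c assume bc: "b \<in> core m k" "c \<in> core m k" "special_set m b = special_set m c"
    obtain H p where B: "core_pattern m b H p" using core_pattern_exists[OF bc(1)] by blast
    obtain L q where C: "core_pattern m c L q" using core_pattern_exists[OF bc(2)] by blast
    have "corner m b = corner m c"
      using pattern_unique B C bc(3) special_set_eq[OF B] special_set_eq[OF C]
      unfolding core_pattern_def by metis
    then show "b = c" using corner_inj B C unfolding core_pattern_def by blast
  qed
  show "special_set m ` core m k = slots m k"
  proof (intro equalityI subsetI)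
    fix Q assume "Q \<in> special_set m ` core m k"
    then obtain b where bQ: "b \<in> core m k" "Q = special_set m b" by blast
    obtain H p where "core_pattern m b H p" using core_pattern_exists[OF bQ(1)] by blast
    then interpret core_pattern m b H p .
    have par: "even (p i + p (Suc i) + int m)" for i using parity_step[of i] by auto
    have mk: "m = 2 * k + back_count H p" by (rule iffD1[OF core_pattern_mem[OF core_pattern_axioms] bQ(1)])
    have "Q = p ` {..<H}" using bQ(2) special_set_eq[OF core_pattern_axioms] by simp
    then show "Q \<in> slots m k" using slotsI[OF periodic_seq_axioms H par mk] by simp
  next
    fix Q assume "Q \<in> slots m k"
    then obtain H p where p: "periodic_seq H (int m) p" "H = 2 \<or> H = 3"
      "\<And>i. even (p i + p (Suc i) + int m)" "m = 2 * k + back_count H p" "Q = p ` {..<H}"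
      unfolding slots_def by blast
    obtain G where G: "pattern (int m) G H p" using pattern_of_seq[OF p(1-3)] by blast
    then obtain b where "core_corner m b" "corner m b = G"
      using core_of_corner_map pattern.axioms(1) by blast
    then have B: "core_pattern m b H p" using G by (simp add: core_pattern_def)
    have "Q = special_set m b" using p(5) special_set_eq[OF B] by simp
    then show "Q \<in> special_set m ` core m k" using iffD2[OF core_pattern_mem[OF B] p(4)] by (rule image_eqI)
  qed
qed

lemma card_core: "card (core m k) = card (slots m k)"
  by (rule bij_betw_same_card[OF bij_betw_special_set])

section \<open>Admissible residues for an even modulus\<close>

lemma slots_pattern:
  assumes "Q \<in> slots m k"
  obtains G H p where "pattern (int m) G H p" "m = 2 * k + back_count H p" "Q = p ` {..<H}"
  using assms pattern_of_seq unfolding slots_def by blast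

lemma card_image_seq:
  assumes "periodic_seq H N p" shows "card (p ` {..<H}) = H"
proof -
  interpret periodic_seq H N p by fact
  show ?thesis by (simp add: card_image inj_on_def eq_iff)
qed

text \<open>All gaps are even, so the residues share one parity, recorded by \<open>e\<close>. Even
  residues come with two back points and odd ones with none, which ties \<open>e\<close> to
  \<open>m - 2 * k\<close>. Conversely any two or three residues of that parity have even gaps, also
  across the end, as \<open>m\<close> is even.\<close>

lemma slots_even_modulus:
  assumes m: "m = 2 * n" and eo: "m = 2 * k + (if e then 2 else 0)"
  shows "slots m k = {Q. Q \<subseteq> {x \<in> {0..<int m}. even x \<longleftrightarrow> e} \<and> (card Q = 2 \<or> card Q = 3)}"
proof (intro equalityI subsetI)
  fix Q assume "Q \<in> slots m k"
  then obtain G H p where pat: "pattern (int m) G H p" and mk: "m = 2 * k + back_count H p" and Q: "Q = p ` {..<H}"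
    by (rule slots_pattern)
  interpret pattern "int m" G H p by fact
  have "\<forall>i. even (p i) \<longleftrightarrow> e"
  proof (cases rule: parity_cases)
    case all_even
    then show ?thesis using back_count(1) mk eo by (cases e) auto
  next
    case all_odd
    then show ?thesis using back_count(2) mk eo by (cases e) auto
  next
    case mixed
    show ?thesis using mixed(1) m by simp
  qed
  then show "Q \<in> {Q. Q \<subseteq> {x \<in> {0..<int m}. even x \<longleftrightarrow> e} \<and> (card Q = 2 \<or> card Q = 3)}"
    using range H card_image_seq[OF periodic_seq_axioms] unfolding Q by auto
next
  fix Q assume "Q \<in> {Q. Q \<subseteq> {x \<in> {0..<int m}. even x \<longleftrightarrow> e} \<and> (card Q = 2 \<or> card Q = 3)}"
  then have Q: "Q \<subseteq> {0..<int m}" "\<And>x. x \<in> Q \<Longrightarrow> even x \<longleftrightarrow> e" "card Q = 2 \<or> card Q = 3" by auto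
  have "finite Q" "Q \<noteq> {}" using Q(3) by (auto intro: card_ge_0_finite)
  then obtain p where p: "periodic_seq (card Q) (int m) p" "p ` {..<card Q} = Q"
    using periodic_seq_exists[OF _ Q(1)] by metis
  interpret p: periodic_seq "card Q" "int m" p by fact
  have ev: "even (p i) \<longleftrightarrow> e" for i
  proof -
    have "even (p i mod int m) \<longleftrightarrow> even (p i)" using m by (simp add: dvd_mod_iff)
    moreover have "p i mod int m \<in> Q" using p.range_iff[of "p i"] p(2) by auto
    ultimately show ?thesis using Q(2) by simp
  qed
  then have par: "even (p i + p (Suc i) + int m)" for i using m by simp
  obtain G where "pattern (int m) G (card Q) p" using pattern_of_seq[OF p(1) Q(3) par] by blast
  then interpret pattern "int m" G "card Q" p .
  have "back_count (card Q) p = (if e then 2 else 0)" using back_count(1,2) ev[of 0] m by simp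
  then have "m = 2 * k + back_count (card Q) p" using eo by simp
  from slotsI[OF p(1) Q(3) par this] show "Q \<in> slots m k" unfolding p(2) .
qed

text \<open>Squares and hexagons together: Pascal's rule merges the two counts into one binomial
  coefficient.\<close>

lemma card_two_or_three_subsets:
  assumes "finite A"
  shows "card {Q. Q \<subseteq> A \<and> (card Q = 2 \<or> card Q = 3)} = Suc (card A) choose 3"
proof -
  have "{Q. Q \<subseteq> A \<and> (card Q = 2 \<or> card Q = 3)} = {Q. Q \<subseteq> A \<and> card Q = 2} \<union> {Q. Q \<subseteq> A \<and> card Q = 3}"
    by blast
  moreover have "finite {Q. Q \<subseteq> A \<and> card Q = c}" for c using assms by simp
  ultimately have "card {Q. Q \<subseteq> A \<and> (card Q = 2 \<or> card Q = 3)} =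
      card {Q. Q \<subseteq> A \<and> card Q = 2} + card {Q. Q \<subseteq> A \<and> card Q = 3}"
    by (simp add: card_Un_disjoint disjoint_iff)
  also have "\<dots> = Suc (card A) choose 3" by (simp add: n_subsets[OF assms] numeral_3_eq_3 numeral_2_eq_2)
  finally show ?thesis .
qed

lemma card_parity_class: "card {x \<in> {0..<int (2 * n)}. even x \<longleftrightarrow> e} = n"
proof -
  have "{x \<in> {0..<int (2 * n)}. even x \<longleftrightarrow> e} = (\<lambda>i. 2 * int i + (if e then 0 else 1)) ` {..<n}"
  proof (intro equalityI subsetI)
    fix x assume x: "x \<in> {x \<in> {0..<int (2 * n)}. even x \<longleftrightarrow> e}"
    have "x = 2 * int (nat (x div 2)) + (if e then 0 else 1)" "nat (x div 2) < n"
      using x by (auto elim!: evenE oddE)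
    then show "x \<in> (\<lambda>i. 2 * int i + (if e then 0 else 1)) ` {..<n}" by blast
  qed (cases e; auto)
  then show ?thesis by (simp add: card_image inj_on_def)
qed

lemma card_slots_even_modulus:
  assumes "2 * n = 2 * k + (if e then 2 else 0)"
  shows "card (slots (2 * n) k) = Suc n choose 3"
proof -
  have "finite {x \<in> {0..<int (2 * n)}. even x \<longleftrightarrow> e}"
    by (rule finite_subset[of _ "{0..<int (2 * n)}"]) auto
  from card_two_or_three_subsets[OF this] show ?thesis
    unfolding slots_even_modulus[OF refl assms] card_parity_class .
qed

lemma card_core_2: "card (core (2 * k + 2) k) = (k + 2) choose 3"
  using card_slots_even_modulus[of "k + 1" k True] by (simp add: card_core)

lemma card_core_0: "card (core (2 * k) k) = (k + 1) choose 3"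
  using card_slots_even_modulus[of k k False] by (simp add: card_core)

section \<open>Admissible residues for an odd modulus\<close>

lemma card_increasing_pairs: "card {(u, v). u < v \<and> v < (n::nat)} = n choose 2"
proof (induction n)
  case (Suc n)
  have fin: "finite {(u, v). u < v \<and> v < n}"
    by (rule finite_subset[of _ "{..<n} \<times> {..<n}"]) auto
  have "{(u, v). u < v \<and> v < Suc n} = {(u, v). u < v \<and> v < n} \<union> (\<lambda>u. (u, n)) ` {..<n}" by auto
  then have "card {(u, v). u < v \<and> v < Suc n} = card {(u, v). u < v \<and> v < n} + card ((\<lambda>u. (u, n)) ` {..<n})"
    using card_Un_disjoint[OF fin, of "(\<lambda>u. (u, n)) ` {..<n}"] by auto
  then show ?case using Suc by (simp add: card_image inj_on_def numeral_2_eq_2)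
qed (simp add: numeral_2_eq_2)

lemma card_increasing_triples: "card {(u, v, w). u < v \<and> v < w \<and> w < (n::nat)} = n choose 3"
proof (induction n)
  case (Suc n)
  have fin: "finite {(u, v, w). u < v \<and> v < w \<and> w < n}"
    by (rule finite_subset[of _ "{..<n} \<times> {..<n} \<times> {..<n}"]) auto
  have fin2: "finite {(u, v). u < v \<and> v < n}"
    by (rule finite_subset[of _ "{..<n} \<times> {..<n}"]) auto
  have "{(u, v, w). u < v \<and> v < w \<and> w < Suc n} =
      {(u, v, w). u < v \<and> v < w \<and> w < n} \<union> (\<lambda>(u, v). (u, v, n)) ` {(u, v). u < v \<and> v < n}"
    by (auto simp: less_Suc_eq)
  moreover have "{(u, v, w). u < v \<and> v < w \<and> w < n} \<inter>
      (\<lambda>(u, v). (u, v, n)) ` {(u, v). u < v \<and> v < n} = {}" by auto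
  ultimately have "card {(u, v, w). u < v \<and> v < w \<and> w < Suc n} = card {(u, v, w). u < v \<and> v < w \<and> w < n} +
      card ((\<lambda>(u, v). (u, v, n)) ` {(u, v). u < v \<and> v < n})"
    using card_Un_disjoint[OF fin finite_imageI[OF fin2]] by simp
  moreover have "card ((\<lambda>(u, v). (u, v, n)) ` {(u, v). u < v \<and> v < n}) = n choose 2"
    unfolding card_increasing_pairs[symmetric] by (rule card_image) (auto simp: inj_on_def)
  ultimately show ?case using Suc by (simp add: numeral_3_eq_3 numeral_2_eq_2)
qed (simp add: numeral_3_eq_3)

lemma increasing_triple_eq:
  fixes x :: "'a :: linorder"
  assumes "{x, y, z} = {x', y', z'}" "x < y" "y < z" "x' < y'" "y' < z'"
  shows "x = x'" "y = y'" "z = z'"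
proof -
  have "Min {x, y, z} = x" "Min {x', y', z'} = x'" using assms(2-5) by (auto simp: min_def)
  then show x: "x = x'" using assms(1) by simp
  have "Max {x, y, z} = z" "Max {x', y', z'} = z'" using assms(2-5) by (auto simp: max_def)
  then show z: "z = z'" using assms(1) by simp
  have "y \<in> {x', y', z'}" using assms(1) by blast
  then show "y = y'" using x z assms(2,3) by auto
qed

definition alternating :: "nat \<Rightarrow> (nat \<times> nat \<times> nat) set" where
  "alternating n = {(x, y, z). x < y \<and> y < z \<and> z < n \<and> (even x \<longleftrightarrow> odd y) \<and> (even y \<longleftrightarrow> odd z)}"

text \<open>Halving the entries of an alternating triple gives a mixture of strict and weak
  inequalities. The shifts in \<open>f\<close> and \<open>g\<close> make all of them strict, with
  the bound \<open>k + 2\<close> if the first entry is even and \<open>k + 1\<close> if it is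
  odd.\<close>

lemma card_alternating: "card (alternating (2 * k + 1)) = ((k + 2) choose 3) + ((k + 1) choose 3)"
proof -
  let ?I = "\<lambda>n. {(u, v, w). u < v \<and> v < w \<and> w < (n::nat)}"
  let ?E = "{(x, y, z) \<in> alternating (2 * k + 1). even x}"
  let ?O = "{(x, y, z) \<in> alternating (2 * k + 1). odd x}"
  define f :: "nat \<times> nat \<times> nat \<Rightarrow> nat \<times> nat \<times> nat"
    where "f = (\<lambda>(u, v, w). (2 * u, 2 * v - 1, 2 * w - 2))"
  define g :: "nat \<times> nat \<times> nat \<Rightarrow> nat \<times> nat \<times> nat"
    where "g = (\<lambda>(u, v, w). (2 * u + 1, 2 * v, 2 * w - 1))"
  have "?E = f ` ?I (k + 2)"
  proof (intro equalityI subsetI)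
    fix t assume "t \<in> ?E"
    then obtain x y z where t: "t = (x, y, z)" "x < y" "y < z" "z < 2 * k + 1"
      and "even x" "odd y" "even z" by (auto simp: alternating_def)
    obtain i where i: "x = 2 * i" using \<open>even x\<close> by (rule evenE)
    obtain j where j: "y = 2 * j + 1" using \<open>odd y\<close> by (rule oddE)
    obtain l where l: "z = 2 * l" using \<open>even z\<close> by (rule evenE)
    have "t = f (i, j + 1, l + 1)" by (simp add: f_def t(1) i j l)
    moreover have "i < j + 1" "j + 1 < l + 1" "l + 1 < k + 2" using t(2-4) i j l by linarith+
    ultimately show "t \<in> f ` ?I (k + 2)" by blast
  next
    fix t assume "t \<in> f ` ?I (k + 2)"
    then obtain u v w where t: "t = (2 * u, 2 * v - 1, 2 * w - 2)" "u < v" "v < w" "w < k + 2"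
      by (auto simp: f_def)
    obtain v' w' where "v = Suc v'" "w = Suc w'" using t(2,3) by (cases v; cases w) auto
    then show "t \<in> ?E" using t by (auto simp: alternating_def)
  qed
  moreover have "inj_on f (?I (k + 2))" by (rule inj_onI) (auto simp: f_def)
  ultimately have E: "card ?E = (k + 2) choose 3"
    by (simp only: card_image card_increasing_triples)
  have "?O = g ` ?I (k + 1)"
  proof (intro equalityI subsetI)
    fix t assume "t \<in> ?O"
    then obtain x y z where t: "t = (x, y, z)" "x < y" "y < z" "z < 2 * k + 1"
      and "odd x" "even y" "odd z" by (auto simp: alternating_def)
    obtain i where i: "x = 2 * i + 1" using \<open>odd x\<close> by (rule oddE)
    obtain j where j: "y = 2 * j" using \<open>even y\<close> by (rule evenE)
    obtain l where l: "z = 2 * l + 1" using \<open>odd z\<close> by (rule oddE)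
    have "t = g (i, j, l + 1)" by (simp add: g_def t(1) i j l)
    moreover have "i < j" "j < l + 1" "l + 1 < k + 1" using t(2-4) i j l by linarith+
    ultimately show "t \<in> g ` ?I (k + 1)" by blast
  next
    fix t assume "t \<in> g ` ?I (k + 1)"
    then obtain u v w where t: "t = (2 * u + 1, 2 * v, 2 * w - 1)" "u < v" "v < w" "w < k + 1"
      by (auto simp: g_def)
    obtain w' where "w = Suc w'" using t(3) by (cases w) auto
    then show "t \<in> ?O" using t by (auto simp: alternating_def)
  qed
  moreover have "inj_on g (?I (k + 1))" by (rule inj_onI) (auto simp: g_def)
  ultimately have O: "card ?O = (k + 1) choose 3"
    by (simp only: card_image card_increasing_triples)
  have fin: "finite (alternating (2 * k + 1))"
    by (rule finite_subset[of _ "{..<2 * k + 1} \<times> {..<2 * k + 1} \<times> {..<2 * k + 1}"])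
      (auto simp: alternating_def)
  have "alternating (2 * k + 1) = ?E \<union> ?O" by auto
  moreover have "card (?E \<union> ?O) = card ?E + card ?O"
    by (rule card_Un_disjoint) (auto intro: finite_subset[OF _ fin])
  ultimately show ?thesis using E O by simp
qed

lemma slots_odd_modulus:
  "slots (2 * k + 1) k = (\<lambda>(x, y, z). {int x, int y, int z}) ` alternating (2 * k + 1)"
proof (intro equalityI subsetI)
  let ?m = "2 * k + 1"
  fix Q assume "Q \<in> slots ?m k"
  then obtain G H p where pat: "pattern (int ?m) G H p" and Q: "Q = p ` {..<H}"
    by (rule slots_pattern)
  interpret pattern "int ?m" G H p by fact
  have odd: "odd (int ?m)" by simp
  have H3: "H = 3" by (cases rule: parity_cases) (use odd in auto)
  have par: "even (p (Suc i)) \<longleftrightarrow> odd (p i)" for i using parity_step[of i] odd by auto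
  have p_range: "0 \<le> p i" "p i < int ?m" if "i < 3" for i using range that H3 by auto
  have "{..<3} = {0, 1, 2 :: nat}" by auto
  then have Qeq: "Q = {int (nat (p 0)), int (nat (p 1)), int (nat (p 2))}"
    using p_nonneg unfolding Q H3 by simp
  have "even (p 1) \<longleftrightarrow> odd (p 0)" "even (p 2) \<longleftrightarrow> odd (p 1)"
    using par[of 0] par[of 1] by (simp_all add: numeral_2_eq_2)
  then have mem: "(nat (p 0), nat (p 1), nat (p 2)) \<in> alternating ?m"
    using less_iff[of 0 1] less_iff[of 1 2] p_range[of 0] p_range[of 1] p_range[of 2]
    by (auto simp: alternating_def even_nat_iff)
  show "Q \<in> (\<lambda>(x, y, z). {int x, int y, int z}) ` alternating ?m"
    by (rule image_eqI[OF _ mem]) (simp only: Qeq prod.case)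
next
  let ?m = "2 * k + 1"
  fix Q assume "Q \<in> (\<lambda>(x, y, z). {int x, int y, int z}) ` alternating ?m"
  then obtain x y z where xyz: "x < y" "y < z" "z < ?m" "even x \<longleftrightarrow> odd y" "even y \<longleftrightarrow> odd z"
    and Q: "Q = {int x, int y, int z}" by (auto simp: alternating_def)
  have cQ: "card Q = 3" using xyz unfolding Q by simp
  have "finite Q" "Q \<subseteq> {0..<int ?m}" "Q \<noteq> {}" using xyz by (auto simp: Q)
  then obtain p where p: "periodic_seq 3 (int ?m) p" "p ` {..<3} = Q"
    using periodic_seq_exists cQ by metis
  interpret p: periodic_seq 3 "int ?m" p by fact
  have "{..<3} = {0, 1, 2 :: nat}" by auto
  then have "{int x, int y, int z} = {p 0, p 1, p 2}" using p(2) Q by simp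
  then have eq: "p 0 = int x" "p 1 = int y" "p 2 = int z"
    using increasing_triple_eq[of "int x" "int y" "int z" "p 0" "p 1" "p 2"] xyz p.less_iff by auto
  \<comment> \<open>For the gap across the end, \<open>p 3 = p 0 + int ?m\<close>, so the condition
    reduces to equal parity of \<open>p 2\<close> and \<open>p 0\<close>, which alternation
    provides. Larger indices follow by periodicity.\<close>
  have par: "even (p i + p (Suc i) + int ?m)" for i
  proof (induction i rule: less_induct)
    case (less i)
    show ?case
    proof (cases "i < 3")
      case True
      then have "i = 0 \<or> i = 1 \<or> i = 2" by linarith
      then show ?thesis using eq p.shift[of 0] xyz by (auto simp: numeral_2_eq_2 numeral_3_eq_3)
    next
      case False
      then have "i - 3 < i" "i = i - 3 + 3" by simp_all
      then show ?thesis using less(1)[of "i - 3"] p.shift[of "i - 3"] p.shift[of "Suc (i - 3)"]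
        by (metis add_Suc even_add)
    qed
  qed
  obtain G where "pattern (int ?m) G 3 p" using pattern_of_seq[OF p(1) _ par] by auto
  then interpret pattern "int ?m" G 3 p .
  have "back_count 3 p = 1" using back_count(3) by simp
  then have "?m = 2 * k + back_count 3 p" by simp
  from slotsI[OF p(1) _ par this] show "Q \<in> slots ?m k" unfolding p(2) by simp
qed

lemma card_core_1: "card (core (2 * k + 1) k) = ((k + 2) choose 3) + ((k + 1) choose 3)"
proof -
  have "inj_on (\<lambda>(x, y, z). {int x, int y, int z}) (alternating (2 * k + 1))"
  proof (rule inj_onI)
    fix s t
    assume st: "s \<in> alternating (2 * k + 1)" "t \<in> alternating (2 * k + 1)"
      "(\<lambda>(x, y, z). {int x, int y, int z}) s = (\<lambda>(x, y, z). {int x, int y, int z}) t"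
    obtain x y z x' y' z' where [simp]: "s = (x, y, z)" "t = (x', y', z')" by (cases s; cases t)
    show "s = t"
      using st increasing_triple_eq[of "int x" "int y" "int z" "int x'" "int y'" "int z'"]
      by (simp add: alternating_def)
  qed
  then show ?thesis
    unfolding card_core slots_odd_modulus by (simp only: card_image card_alternating)
qed

section \<open>Summation over the sets of kept points\<close>

lemma r_back_eq: "r_back j n k = (n choose (2 * k + j)) * card (core (2 * k + j) k)"
proof -
  let ?P = "\<lambda>\<alpha>. card (back_points n \<alpha>) = j"
  let ?D = "SIGMA S:Pow {1..n}. core (card S) k"
  have inj: "inj_on (expand n) ?D" and img: "expand n ` ?D = reduced_genus_one n k"
    using bij_betw_expand unfolding bij_betw_def by blast+
  \<comment> \<open>A core with \<open>k\<close> cycles has \<open>card S - 2 * k\<close> back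
    points, so prescribing \<open>j\<close> prescribes the size of \<open>S\<close>. The choices of
    \<open>S\<close> and of the core are then independent.\<close>
  have iff: "?P (expand n (S, b)) \<longleftrightarrow> card S = 2 * k + j" if "(S, b) \<in> ?D" for S b
    using that card_back_points_expand[of S n b k] card_core_back_points(1)[of b "card S" k] by auto
  define E where "E = (SIGMA S:{S. S \<subseteq> {1..n} \<and> card S = 2 * k + j}. core (2 * k + j) k)"
  have ED: "E \<subseteq> ?D" by (auto simp: E_def)
  have "{\<alpha> \<in> reduced_genus_one n k. ?P \<alpha>} = expand n ` E"
  proof (intro equalityI subsetI)
    fix \<alpha> assume \<alpha>: "\<alpha> \<in> {\<alpha> \<in> reduced_genus_one n k. ?P \<alpha>}"
    then have "\<alpha> \<in> expand n ` ?D" unfolding img by simp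
    then obtain t where t: "\<alpha> = expand n t" "t \<in> ?D" by (rule imageE)
    obtain S b where [simp]: "t = (S, b)" by (cases t)
    have Sb: "(S, b) \<in> ?D" "\<alpha> = expand n (S, b)" using t by simp_all
    then have "(S, b) \<in> E" using iff[OF Sb(1)] \<alpha> by (auto simp: E_def)
    then show "\<alpha> \<in> expand n ` E" using Sb(2) by blast
  next
    fix \<alpha> assume "\<alpha> \<in> expand n ` E"
    then obtain S b where Sb: "(S, b) \<in> E" "\<alpha> = expand n (S, b)" by (auto simp: E_def)
    then have D: "(S, b) \<in> ?D" and "card S = 2 * k + j" using ED by (auto simp: E_def)
    then have "?P \<alpha>" using iff[OF D] Sb(2) by simp
    moreover have "\<alpha> \<in> reduced_genus_one n k" unfolding img[symmetric] Sb(2) using D by (rule imageI)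
    ultimately show "\<alpha> \<in> {\<alpha> \<in> reduced_genus_one n k. ?P \<alpha>}" by simp
  qed
  then have "r_back j n k = card E"
    unfolding r_back_def using card_image[OF inj_on_subset[OF inj ED]] by simp
  also have "\<dots> = (n choose (2 * k + j)) * card (core (2 * k + j) k)"
  proof -
    have "card E = card {S. S \<subseteq> {1..n} \<and> card S = 2 * k + j} * card (core (2 * k + j) k)"
      unfolding E_def by (rule card_cartesian_product)
    then show ?thesis using n_subsets[of "{1..n}" "2 * k + j"] by simp
  qed
  finally show ?thesis .
qed

lemma r_total_eq: "r_total n k = r_back 0 n k + r_back 1 n k + r_back 2 n k"
proof -
  let ?R = "\<lambda>j. {\<alpha> \<in> reduced_genus_one n k. card (back_points n \<alpha>) = j}"
  have "finite (reduced_genus_one n k)"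
    by (rule finite_subset[OF _ finite_permutations[of "{1..n}"]]) (auto simp: reduced_genus_one_def)
  then have fin: "finite (?R j)" for j by simp
  have "card (back_points n \<alpha>) \<le> 2" if \<alpha>: "\<alpha> \<in> reduced_genus_one n k" for \<alpha>
  proof -
    obtain S b where "S \<subseteq> {1..n}" "b \<in> core (card S) k" "\<alpha> = expand n (S, b)"
      using expand_surj[OF \<alpha>] by auto
    then show ?thesis using card_back_points_expand card_core_back_points(2) by simp
  qed
  then have "reduced_genus_one n k = (?R 0 \<union> ?R 1) \<union> ?R 2" by (auto simp: le_Suc_eq numeral_2_eq_2)
  then have "card (reduced_genus_one n k) = card ((?R 0 \<union> ?R 1) \<union> ?R 2)" by simp
  also have "\<dots> = card (?R 0 \<union> ?R 1) + card (?R 2)"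
    by (rule card_Un_disjoint) (use fin in auto)
  also have "card (?R 0 \<union> ?R 1) = card (?R 0) + card (?R 1)"
    by (rule card_Un_disjoint) (use fin in auto)
  finally show ?thesis by (simp only: r_total_def r_back_def)
qed

theorem theorem4p4:
  fixes n k :: nat
  assumes "n \<ge> 1" and "k \<ge> 1"
  shows "r_total n k =
           ((n + 2) choose (2 * k + 2)) * ((k + 1) choose 3) +
           ((n + 1) choose (2 * k + 2)) * ((k + 1) choose 2) \<and>
         r_back 0 n k = (n choose (2 * k)) * ((k + 1) choose 3) \<and>
         r_back 2 n k = (n choose (2 * k + 2)) * ((k + 2) choose 3) \<and>
         r_back 1 n k =
           (n choose (2 * k + 1)) * (((k + 2) choose 3) + ((k + 1) choose 3))"
proof -
  have 0: "r_back 0 n k = (n choose (2 * k)) * ((k + 1) choose 3)"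
    using r_back_eq[of 0 n k] card_core_0 by simp
  have 1: "r_back 1 n k = (n choose (2 * k + 1)) * (((k + 2) choose 3) + ((k + 1) choose 3))"
    using r_back_eq[of 1 n k] card_core_1 by simp
  have 2: "r_back 2 n k = (n choose (2 * k + 2)) * ((k + 2) choose 3)"
    using r_back_eq[of 2 n k] card_core_2 by simp
  \<comment> \<open>Pascal's rule, applied in \<open>k\<close> and up to twice in \<open>n\<close>,
    brings both sides to the same combination of \<open>n choose (2 * k)\<close>,
    \<open>n choose (2 * k + 1)\<close> and \<open>n choose (2 * k + 2)\<close>.\<close>
  have k2: "(k + 2) choose 3 = ((k + 1) choose 2) + ((k + 1) choose 3)"
    by (simp add: numeral_3_eq_3 numeral_2_eq_2)
  have n1: "(n + 1) choose (2 * k + 2) = (n choose (2 * k + 1)) + (n choose (2 * k + 2))"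
    by simp
  have n2: "(n + 2) choose (2 * k + 2) =
      (n choose (2 * k)) + 2 * (n choose (2 * k + 1)) + (n choose (2 * k + 2))"
    by simp
  have "r_total n k = ((n + 2) choose (2 * k + 2)) * ((k + 1) choose 3) +
      ((n + 1) choose (2 * k + 2)) * ((k + 1) choose 2)"
    unfolding r_total_eq 0 1 2 n1 n2 k2 by (simp add: algebra_simps)
  then show ?thesis using 0 1 2 by blast
qed

end
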